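(* Let $G$ be a graph with $n$ nodes and $m$ edges, and let $H$ be a graph with $p \leq \log n$ nodes and $k$ edges. Let $\tilde{m}=\max\{m,n^{1+1/p}\}$. There exists a deterministic Congested Clique algorithm that terminates in $O\!\left(\frac{k\tilde{m}}{n^{1+2/p}} + p\right)$ rounds and lists all instances of $H$ in $G$.
   Context: Congested Clique model: the $n$ vertices of the input graph $G$ are $n$ synchronous processors; in each round every pair of processors may exchange a message of $O(\log n)$ bits. Initially each node knows only the edges of $G$ incident to it. Listing all instances of $H$ means that each node outputs a set of copies of $H$ in $G$, and the union of the outputs of all nodes is exactly the set of all copies of $H$ in $G$. *)

theory Defs
  imports Complex_Main
begin

record ugraph =
  verts :: "nat set"
  edges :: "nat set set"

definition simple_graph :: "ugraph \<Rightarrow> bool" where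
  "simple_graph G \<longleftrightarrow> finite (verts G) \<and> (\<forall>e \<in> edges G. e \<subseteq> verts G \<and> card e = 2)"

definition incident :: "ugraph \<Rightarrow> nat \<Rightarrow> nat set set" where
  "incident G v = {e \<in> edges G. v \<in> e}"

definition subgraph :: "ugraph \<Rightarrow> ugraph \<Rightarrow> bool" where
  "subgraph K G \<longleftrightarrow> simple_graph K \<and> verts K \<subseteq> verts G \<and> edges K \<subseteq> edges G"

definition isomorphic :: "ugraph \<Rightarrow> ugraph \<Rightarrow> bool" where
  "isomorphic H K \<longleftrightarrow>
     (\<exists>f. bij_betw f (verts H) (verts K) \<and> edges K = (\<lambda>e. f ` e) ` edges H)"

text \<open>The instances of \<open>H\<close> in \<open>G\<close> are the (not necessarily induced) subgraphs of \<open>G\<close> that are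
  isomorphic to \<open>H\<close>.\<close>

definition copies :: "ugraph \<Rightarrow> ugraph \<Rightarrow> ugraph set" where
  "copies H G = {K. subgraph K G \<and> isomorphic H K}"

text \<open>Local computation is unbounded, so a deterministic algorithm is given by functions of a node's
  local view: its own identifier, the edges incident to it, and the list of inboxes it has received
  so far, one per completed round. An inbox maps each sender to the message it sent, the empty
  message standing for silence. The messages that the node itself has sent are determined by this
  view.

  \<open>send A v I h u\<close> is the message that \<open>v\<close> sends to \<open>u\<close> in the round after the view \<open>(v, I, h)\<close>.
  \<open>decide A v I h\<close> is \<open>None\<close> if \<open>v\<close> continues, and \<open>Some S\<close> if it halts and outputs \<open>S\<close>.\<close>

type_synonym message = "bool list"
type_synonym inbox = "nat \<Rightarrow> message"

record cc_algorithm =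
  send :: "nat \<Rightarrow> nat set set \<Rightarrow> inbox list \<Rightarrow> nat \<Rightarrow> message"
  decide :: "nat \<Rightarrow> nat set set \<Rightarrow> inbox list \<Rightarrow> ugraph set option"

text \<open>Halting is irrevocable: a view is halted as soon as the node has decided on some prefix of it,
  and a halted node stays silent.\<close>

definition halted :: "cc_algorithm \<Rightarrow> nat \<Rightarrow> nat set set \<Rightarrow> inbox list \<Rightarrow> bool" where
  "halted A v I h \<longleftrightarrow> (\<exists>s \<le> length h. decide A v I (take s h) \<noteq> None)"

definition transmitted :: "cc_algorithm \<Rightarrow> nat \<Rightarrow> nat set set \<Rightarrow> inbox list \<Rightarrow> nat \<Rightarrow> message" where
  "transmitted A v I h u = (if halted A v I h then [] else send A v I h u)"

text \<open>\<open>history A G r v\<close> lists the inboxes of node \<open>v\<close> in the first \<open>r\<close> rounds of the execution of \<open>A\<close>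
  on the input graph \<open>G\<close>, whose vertices are the processors.\<close>

primrec history :: "cc_algorithm \<Rightarrow> ugraph \<Rightarrow> nat \<Rightarrow> nat \<Rightarrow> inbox list" where
  "history A G 0 = (\<lambda>v. [])"
| "history A G (Suc r) = (\<lambda>v. history A G r v @
     [\<lambda>u. if u \<in> verts G \<and> u \<noteq> v
          then transmitted A u (incident G u) (history A G r u) v else []])"

definition bandwidth_at_most :: "cc_algorithm \<Rightarrow> ugraph \<Rightarrow> real \<Rightarrow> bool" where
  "bandwidth_at_most A G b \<longleftrightarrow>
     (\<forall>r. \<forall>u \<in> verts G. \<forall>v \<in> verts G. u \<noteq> v \<longrightarrow>
        real (length (transmitted A u (incident G u) (history A G r u) v)) \<le> b)"

definition terminates_within :: "cc_algorithm \<Rightarrow> ugraph \<Rightarrow> real \<Rightarrow> bool" where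
  "terminates_within A G t \<longleftrightarrow>
     (\<exists>T. real T \<le> t \<and> (\<forall>v \<in> verts G. halted A v (incident G v) (history A G T v)))"

text \<open>The output is the first decision of the node (only meaningful if the node halts at all).\<close>

definition node_output :: "cc_algorithm \<Rightarrow> ugraph \<Rightarrow> nat \<Rightarrow> ugraph set" where
  "node_output A G v =
     (let T = (LEAST r. decide A v (incident G v) (history A G r v) \<noteq> None)
      in the (decide A v (incident G v) (history A G T v)))"

definition lists_all_copies :: "cc_algorithm \<Rightarrow> ugraph \<Rightarrow> ugraph \<Rightarrow> bool" where
  "lists_all_copies A H G \<longleftrightarrow> (\<Union>v \<in> verts G. node_output A G v) = copies H G"

definition padded_edges :: "nat \<Rightarrow> nat \<Rightarrow> nat \<Rightarrow> real" where
  "padded_edges n m p = max (real m) (real n powr (1 + 1 / real p))"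

definition round_bound :: "nat \<Rightarrow> nat \<Rightarrow> nat \<Rightarrow> nat \<Rightarrow> real" where
  "round_bound n m p k =
     real k * padded_edges n m p / real n powr (1 + 2 / real p) + real p"

end

theory Submission
  imports Defs "HOL-Library.FuncSet"
begin

text \<open>Number the vertices of \<open>H\<close> by \<open>0, \<dots>, p - 1\<close> and let \<open>N\<close> be about the \<open>p\<close>-th root of \<open>n\<close>. Every
  processor is responsible for a tuple \<open>t\<close> of \<open>p\<close> numbers below \<open>N\<close>, and a vertex set \<open>S t j\<close> is attached to
  the prefix \<open>t 0, \<dots>, t j\<close>: given the sets of the shorter prefixes, \<open>V\<close> is cut into \<open>N\<close> intervals that
  balance the size, the degrees and the number of edges to the sets \<open>S t i\<close> with \<open>i < j\<close> adjacent to \<open>j\<close>,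
  and \<open>t j\<close> selects one of them. With \<open>M = max m (n * N)\<close> no vertex is too heavy for such a cut, so the
  processor \<open>t\<close> needs only \<open>O(d * M / N\<^sup>2)\<close> edges at level \<open>j\<close>, where \<open>d\<close> is the number of these \<open>i\<close>; and
  every copy of \<open>H\<close> follows some tuple. Intervals can be announced in one round.

  Routing: the edges, sorted by their first end point, are dealt out round robin. The edges with first
  end point in an interval are then spread evenly over all processors. The team of the \<open>N\<close> tuples that
  differ only at \<open>j\<close> wants edges whose first end points lie in the same intervals; it collects them
  evenly and then redistributes them internally. The \<open>N \<times> N\<close> matrix of internal demands has at
  most \<open>n\<close> entries and is shared through one relay per entry, so the whole team knows it and agrees on a balanced edge colouring of this
  bipartite multigraph, whose colours are the processors that serve as relays.\<close>

subsection \<open>Balanced colourings and interval partitions\<close>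

text \<open>Joining every \<open>x\<close> to \<open>f x\<close> and \<open>g x\<close> yields paths
  and cycles that alternate between the two involutions, so all cycles are even. The induction
  removes either an \<open>f\<close>-fixed point, whose \<open>g\<close>-partner becomes fixed, or a
  whole \<open>f\<close>-pair.\<close>

lemma two_involutions_coloring:
  assumes "finite X"
    and "\<And>x. x \<in> X \<Longrightarrow> f x \<in> X \<and> f (f x) = x"
    and "\<And>x. x \<in> X \<Longrightarrow> g x \<in> X \<and> g (g x) = x"
  shows "\<exists>c :: 'a \<Rightarrow> bool. \<forall>x \<in> X. (f x \<noteq> x \<longrightarrow> c (f x) \<noteq> c x) \<and> (g x \<noteq> x \<longrightarrow> c (g x) \<noteq> c x)"
  using assms
proof (induction "card X" arbitrary: X f g rule: less_induct)
  case less
  note fin = less.prems(1) and f = less.prems(2) and g = less.prems(3)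
  show ?case
  proof (cases "X = {}")
    case False
    then obtain x where x: "x \<in> X" by blast
    show ?thesis
    proof (cases "f x = x")
      case True
      define g' where "g' z = (if g z = x then z else g z)" for z
      have "\<exists>c :: 'a \<Rightarrow> bool. \<forall>z \<in> X - {x}. (f z \<noteq> z \<longrightarrow> c (f z) \<noteq> c z) \<and> (g' z \<noteq> z \<longrightarrow> c (g' z) \<noteq> c z)"
      proof (rule less.hyps)
        show "card (X - {x}) < card X"
        by (rule psubset_card_mono[OF fin]) (use x in blast)
        show "f z \<in> X - {x} \<and> f (f z) = z" if "z \<in> X - {x}" for z
          using f[of z] that True by auto
        show "g' z \<in> X - {x} \<and> g' (g' z) = z" if "z \<in> X - {x}" for z
          using g[of z] g[of x] that x by (auto simp: g'_def)
      qed (use fin in simp)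
      then obtain c :: "'a \<Rightarrow> bool" where c: "\<forall>z \<in> X - {x}. (f z \<noteq> z \<longrightarrow> c (f z) \<noteq> c z) \<and> (g' z \<noteq> z \<longrightarrow> c (g' z) \<noteq> c z)" ..
      define c' where "c' = c(x := \<not> c (g x))"
      have "(f z \<noteq> z \<longrightarrow> c' (f z) \<noteq> c' z) \<and> (g z \<noteq> z \<longrightarrow> c' (g z) \<noteq> c' z)" if z: "z \<in> X" for z
      proof (cases "z = x")
        case True
        then show ?thesis using \<open>f x = x\<close> by (simp add: c'_def)
      next
        case False
        have "f z \<noteq> x" using f[OF z] \<open>f x = x\<close> False by metis
        moreover have "g' z = g z" if "g z \<noteq> x" using that by (simp add: g'_def)
        moreover have "g x = z" if "g z = x" using g[OF z] that by simp
        ultimately show ?thesis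
          using c[rule_format, of z] z False unfolding c'_def by auto
      qed
      then show ?thesis by blast
    next
      case False
      define y where "y = f x"
      have y: "y \<in> X" "y \<noteq> x" "f y = x"
        using f x False by (auto simp: y_def)
      \<comment> \<open>\<open>g'\<close> bypasses the deleted pair: the \<open>g\<close>-partners
        of \<open>x\<close> and \<open>y\<close> become partners of each other. They then receive
        different colours, so \<open>x\<close> and \<open>y\<close> can be coloured differently from
        each other and from their partners.\<close>
      define g' where "g' z = (if g z = x then (if g y = y then z else g y)
          else if g z = y then (if g x = x then z else g x) else g z)" for z
      have "\<exists>c :: 'a \<Rightarrow> bool. \<forall>z \<in> X - {x, y}. (f z \<noteq> z \<longrightarrow> c (f z) \<noteq> c z) \<and> (g' z \<noteq> z \<longrightarrow> c (g' z) \<noteq> c z)"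
      proof (rule less.hyps)
        show "card (X - {x, y}) < card X"
        by (rule psubset_card_mono[OF fin]) (use x in blast)
        show "f z \<in> X - {x, y} \<and> f (f z) = z" if "z \<in> X - {x, y}" for z
      proof -
        have "f z \<noteq> x" "f z \<noteq> y" using f[of z] that y by (metis DiffD1 DiffD2 insertI1 insertI2 y_def)+
        then show ?thesis using f[of z] that by simp
      qed
        show "g' z \<in> X - {x, y} \<and> g' (g' z) = z" if "z \<in> X - {x, y}" for z
      proof -
        have z: "z \<in> X" "z \<noteq> x" "z \<noteq> y" using that by auto
        note gg = g[OF z(1)] g[OF x] g[OF y(1)]
        consider "g z = x" | "g z = y" | "g z \<noteq> x" "g z \<noteq> y" by blast
        then show ?thesis
        proof cases
          case 1
          then have "g x = z" using gg by simp
          then show ?thesis using gg 1 z y(2) unfolding g'_def by (smt (verit) DiffI insertE singletonD)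
        next
          case 2
          then have "g y = z" using gg by simp
          then show ?thesis using gg 2 z y(2) unfolding g'_def by (smt (verit) DiffI insertE singletonD)
        next
          case 3
          then show ?thesis using gg z unfolding g'_def by (smt (verit) DiffI insertE singletonD)
        qed
      qed
      qed (use fin in simp)
      then obtain c :: "'a \<Rightarrow> bool" where c: "\<forall>z \<in> X - {x, y}. (f z \<noteq> z \<longrightarrow> c (f z) \<noteq> c z) \<and> (g' z \<noteq> z \<longrightarrow> c (g' z) \<noteq> c z)" ..
      \<comment> \<open>If \<open>g x\<close> lies outside the pair, \<open>x\<close> avoids its
        colour. Otherwise at most \<open>y\<close> is constrained from outside, and
        \<open>cx\<close> is chosen so that \<open>y\<close> avoids the colour of
        \<open>g y\<close>.\<close>
      define cx where "cx = (if g x \<notin> {x, y} then \<not> c (g x) else c (g y))"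
      define c' where "c' = c(x := cx, y := \<not> cx)"
      have "f z \<noteq> z \<longrightarrow> c' (f z) \<noteq> c' z" if "z \<in> X" for z
      proof (cases "z \<in> {x, y}")
        case True
        then show ?thesis using y by (auto simp: c'_def simp flip: y_def)
      next
        case False
        then have "f z \<noteq> x" "f z \<noteq> y" using f[OF that] y by (metis insertI1 insertI2 y_def)+
        then show ?thesis using False c that by (simp add: c'_def)
      qed
      moreover have "g z \<noteq> z \<longrightarrow> c' (g z) \<noteq> c' z" if z: "z \<in> X" for z
      proof (intro impI)
        assume ne: "g z \<noteq> z"
        have gx: "g x \<in> X" "g (g x) = x" and gy: "g y \<in> X" "g (g y) = y"
          and gz: "g z \<in> X" "g (g z) = z" using g x y z by auto
        have A: "c (g x) \<noteq> c (g y)" if "g x \<notin> {x, y}" "g y \<notin> {x, y}"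
        proof -
          have "g' (g x) = g y" using gx that by (auto simp: g'_def)
          moreover have "g y \<noteq> g x" using gx gy y by metis
          moreover have "g x \<in> X - {x, y}" using gx that by simp
          ultimately show ?thesis using c by metis
        qed
        have X: "c' (g x) \<noteq> c' x" if "g x \<noteq> x"
          using that gx gy y by (auto simp: c'_def cx_def)
        have Y: "c' (g y) \<noteq> c' y" if "g y \<noteq> y"
        proof (cases "g y = x")
          case True
          then show ?thesis using y by (auto simp: c'_def)
        next
          case False
          then have gyn: "g y \<notin> {x, y}" using that by auto
          show ?thesis
          proof (cases "g x \<in> {x, y}")
            case True
            then show ?thesis using gyn y by (auto simp: c'_def cx_def)
          next
            case False
            then show ?thesis using gyn y A by (auto simp: c'_def cx_def)
          qed
        qed
        show "c' (g z) \<noteq> c' z"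
        proof (cases "z \<in> {x, y} \<or> g z \<in> {x, y}")
          case True
          then consider "z = x" | "z = y" | "g z = x" | "g z = y" by blast
          then show ?thesis
          proof cases
            case 3
            then show ?thesis using X gz ne by metis
          next
            case 4
            then show ?thesis using Y gz ne by metis
          qed (use X Y ne in auto)
        next
          case False
          then have "g' z = g z" by (auto simp: g'_def)
          then have "c (g z) \<noteq> c z" using c[rule_format, of z] z False ne by auto
          then show ?thesis using False by (auto simp: c'_def)
        qed
      qed
      ultimately show ?thesis by blast
    qed
  qed simp
qed

definition is_pairing :: "'a set \<Rightarrow> ('a \<Rightarrow> 'a) \<Rightarrow> bool" where
  "is_pairing A f \<longleftrightarrow> (\<forall>x \<in> A. f x \<in> A \<and> f (f x) = x) \<and> card {x \<in> A. f x = x} \<le> 1"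

lemma pairing_exists:
  assumes "finite A"
  shows "\<exists>f. is_pairing A f"
  using assms unfolding is_pairing_def
proof (induction "card A" arbitrary: A rule: less_induct)
  case less
  show ?case
  proof (cases "card A \<le> 1")
    case True
    then show ?thesis by (intro exI[of _ "\<lambda>x. x"]) simp
  next
    case False
    then obtain x y where xy: "x \<in> A" "y \<in> A" "x \<noteq> y"
      using less.prems by (metis One_nat_def card_le_Suc0_iff_eq)
    have lt: "card (A - {x, y}) < card A"
      by (rule psubset_card_mono[OF less.prems]) (use xy in blast)
    obtain f where f: "\<forall>z \<in> A - {x, y}. f z \<in> A - {x, y} \<and> f (f z) = z"
        "card {z \<in> A - {x, y}. f z = z} \<le> 1"
      using less.hyps[OF lt finite_Diff[OF less.prems]] by blast
    have "{z \<in> A. (f(x := y, y := x)) z = z} = {z \<in> A - {x, y}. f z = z}"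
      using xy by auto
    moreover have "\<forall>z \<in> A. (f(x := y, y := x)) z \<in> A \<and> (f(x := y, y := x)) ((f(x := y, y := x)) z) = z"
      using f(1) xy by auto
    ultimately show ?thesis using f(2) by (intro exI[of _ "f(x := y, y := x)"]) simp
  qed
qed

text \<open>The involution injects the non-fixed elements of one colour into the other colour; the
  single possible fixed point causes the \<open>+ 1\<close>.\<close>

lemma card_color_class_le:
  assumes "finite A" "\<And>x. x \<in> A \<Longrightarrow> f x \<in> A \<and> f (f x) = x" "card {x \<in> A. f x = x} \<le> 1"
    and c: "\<And>x. x \<in> A \<Longrightarrow> f x \<noteq> x \<Longrightarrow> c (f x) \<noteq> (c x :: bool)"
  shows "2 * card {x \<in> A. c x = d} \<le> card A + 1"
proof -
  let ?F = "{x \<in> A. f x = x}" and ?B = "{x \<in> A. c x = d \<and> f x \<noteq> x}" and ?D = "{x \<in> A. c x \<noteq> d}"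
  have "inj_on f ?B" by (rule inj_on_inverseI[of _ f]) (use assms(2) in auto)
  moreover have "f ` ?B \<subseteq> ?D" using assms(2) c by blast
  ultimately have "card ?B \<le> card ?D"
    using assms(1) card_inj_on_le[of f ?B ?D] by simp
  moreover have "card {x \<in> A. c x = d} \<le> card (?B \<union> ?F)"
    using assms(1) by (intro card_mono) auto
  moreover have "card (?B \<union> ?F) \<le> card ?B + card ?F" by (rule card_Un_le)
  moreover have "card A = card {x \<in> A. c x = d} + card ?D"
  proof -
    have "A = {x \<in> A. c x = d} \<union> ?D" by blast
    moreover have "card ({x \<in> A. c x = d} \<union> ?D) = card {x \<in> A. c x = d} + card ?D"
      using assms(1) by (intro card_Un_disjoint) auto
    ultimately show ?thesis by argo
  qed
  ultimately show ?thesis using assms(3) by linarith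
qed

text \<open>View \<open>X\<close> as the edges of a bipartite multigraph. Pairing up the edges at
  every source and at every destination gives two involutions, and a colouring that separates all
  pairs halves every degree up to rounding.\<close>

lemma balanced_bipartition:
  fixes src :: "'a \<Rightarrow> 'b" and dst :: "'a \<Rightarrow> 'c"
  assumes "finite X"
  shows "\<exists>c :: 'a \<Rightarrow> bool. \<forall>d.
    (\<forall>s. 2 * card {x \<in> X. src x = s \<and> c x = d} \<le> card {x \<in> X. src x = s} + 1) \<and>
    (\<forall>s. 2 * card {x \<in> X. dst x = s \<and> c x = d} \<le> card {x \<in> X. dst x = s} + 1)"
proof -
  have "\<exists>f. is_pairing {x \<in> X. src x = s} f" for s
    by (rule pairing_exists) (use assms in simp)
  then obtain f where f: "\<And>s. is_pairing {x \<in> X. src x = s} (f s)"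
    by metis
  have "\<exists>g. is_pairing {x \<in> X. dst x = s} g" for s
    by (rule pairing_exists) (use assms in simp)
  then obtain g where g: "\<And>s. is_pairing {x \<in> X. dst x = s} (g s)"
    by metis
  obtain c :: "'a \<Rightarrow> bool" where c: "\<forall>x \<in> X. (f (src x) x \<noteq> x \<longrightarrow> c (f (src x) x) \<noteq> c x) \<and>
      (g (dst x) x \<noteq> x \<longrightarrow> c (g (dst x) x) \<noteq> c x)"
  proof -
    have "f (src x) x \<in> X \<and> f (src (f (src x) x)) (f (src x) x) = x"
      "g (dst x) x \<in> X \<and> g (dst (g (dst x) x)) (g (dst x) x) = x" if "x \<in> X" for x
      using f[of "src x"] g[of "dst x"] that unfolding is_pairing_def by auto
    then show thesis
      using two_involutions_coloring[of X "\<lambda>x. f (src x) x" "\<lambda>x. g (dst x) x"] assms that by blast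
  qed
  have "2 * card {x \<in> {x \<in> X. src x = s}. c x = d} \<le> card {x \<in> X. src x = s} + 1" for s d
    by (rule card_color_class_le[where f = "f s"]) (use assms f[of s] c in \<open>auto simp: is_pairing_def\<close>)
  moreover have "2 * card {x \<in> {x \<in> X. dst x = s}. c x = d} \<le> card {x \<in> X. dst x = s} + 1" for s d
    by (rule card_color_class_le[where f = "g s"]) (use assms g[of s] c in \<open>auto simp: is_pairing_def\<close>)
  ultimately show ?thesis by (intro exI[of _ c]) (simp add: conj_assoc)
qed

text \<open>Repeated halving. The additive error stays 1 because a bound
  \<open>D / 2 ^ r + 1\<close> turns into \<open>((D / 2 ^ r + 1) + 1) / 2\<close>.\<close>

lemma balanced_coloring:
  assumes "finite X"
  shows "\<exists>col :: 'a \<Rightarrow> nat. (\<forall>x \<in> X. col x < 2 ^ r) \<and>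
    (\<forall>s z. real (card {x \<in> X. src x = s \<and> col x = z}) \<le> card {x \<in> X. src x = s} / 2 ^ r + 1) \<and>
    (\<forall>s z. real (card {x \<in> X. dst x = s \<and> col x = z}) \<le> card {x \<in> X. dst x = s} / 2 ^ r + 1)"
proof (induction r)
  case 0
  have "real (card {x \<in> X. P x \<and> 0 = z}) \<le> real (card {x \<in> X. P x}) / 2 ^ 0 + 1" for z :: nat and P
  proof -
    have "card {x \<in> X. P x \<and> 0 = z} \<le> card {x \<in> X. P x}"
      using assms by (intro card_mono) auto
    then show ?thesis by simp
  qed
  then show ?case by (intro exI[of _ "\<lambda>_. 0"]) simp
next
  case (Suc r)
  then obtain col :: "'a \<Rightarrow> nat" where col: "\<forall>x \<in> X. col x < 2 ^ r"
    "\<And>s z. real (card {x \<in> X. src x = s \<and> col x = z}) \<le> card {x \<in> X. src x = s} / 2 ^ r + 1"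
    "\<And>s z. real (card {x \<in> X. dst x = s \<and> col x = z}) \<le> card {x \<in> X. dst x = s} / 2 ^ r + 1"
    by blast
  \<comment> \<open>Using the old colour as part of the end points splits all colour classes at
    once.\<close>
  obtain c :: "'a \<Rightarrow> bool" where c: "\<And>d s. 2 * card {x \<in> X. (src x, col x) = s \<and> c x = d} \<le> card {x \<in> X. (src x, col x) = s} + 1"
     "\<And>d s. 2 * card {x \<in> X. (dst x, col x) = s \<and> c x = d} \<le> card {x \<in> X. (dst x, col x) = s} + 1"
    using balanced_bipartition[OF assms, of "\<lambda>x. (src x, col x)" "\<lambda>x. (dst x, col x)"] by blast
  define col' where "col' x = 2 * col x + of_bool (c x)" for x
  have *: "col' x = z \<longleftrightarrow> col x = z div 2 \<and> c x = odd z" for x z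
    unfolding col'_def by (cases "c x"; simp; presburger)
  have "real (card {x \<in> X. src x = s \<and> col' x = z}) \<le> card {x \<in> X. src x = s} / 2 ^ Suc r + 1" for s z
  proof -
    have "2 * card {x \<in> X. src x = s \<and> col' x = z} \<le> card {x \<in> X. src x = s \<and> col x = z div 2} + 1"
      using c(1)[of "(s, z div 2)" "odd z"] by (simp add: * conj_assoc)
    then have "2 * real (card {x \<in> X. src x = s \<and> col' x = z}) \<le> card {x \<in> X. src x = s \<and> col x = z div 2} + 1"
      by linarith
    then show ?thesis using col(2)[of s "z div 2"] by simp
  qed
  moreover have "real (card {x \<in> X. dst x = s \<and> col' x = z}) \<le> card {x \<in> X. dst x = s} / 2 ^ Suc r + 1" for s z
  proof -
    have "2 * card {x \<in> X. dst x = s \<and> col' x = z} \<le> card {x \<in> X. dst x = s \<and> col x = z div 2} + 1"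
      using c(2)[of "(s, z div 2)" "odd z"] by (simp add: * conj_assoc)
    then have "2 * real (card {x \<in> X. dst x = s \<and> col' x = z}) \<le> card {x \<in> X. dst x = s \<and> col x = z div 2} + 1"
      by linarith
    then show ?thesis using col(3)[of s "z div 2"] by simp
  qed
  moreover have "\<forall>x \<in> X. col' x < 2 ^ Suc r"
  proof
    fix x assume "x \<in> X"
    then have "col x + 1 \<le> 2 ^ r" using col(1) by fastforce
    then show "col' x < 2 ^ Suc r" by (simp add: col'_def)
  qed
  ultimately show ?case by (intro exI[of _ col'] conjI allI)
qed

section \<open>Residue classes and numberings of finite sets\<close>

text \<open>Numbers with equal residue differ by at least \<open>n\<close>, so they fall into
  different blocks of length \<open>n\<close>. Thanks to \<open>l - 1\<close> the bound is exactly 1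
  for windows of length up to \<open>n\<close>, which the one-round dealing of edges relies
  on.\<close>

lemma card_residue_window:
  fixes a l n :: nat
  assumes "n > 0"
  shows "card {r \<in> {a..<a + l}. r mod n = c} \<le> (l - 1) div n + 1"
proof -
  let ?R = "{r \<in> {a..<a + l}. r mod n = c}"
  have "inj_on (\<lambda>r. (r - a) div n) ?R"
  proof (rule linorder_inj_onI')
    fix r s assume rs: "r \<in> ?R" "s \<in> ?R" "r < s"
    then have "n dvd s - r" using mod_eq_dvd_iff_nat[of r s n] by simp
    then have "n \<le> s - r" using rs by (intro dvd_imp_le) auto
    then have "s - a \<ge> (r - a) + n" using rs by auto
    then have "(s - a) div n \<ge> ((r - a) + n) div n" by (rule div_le_mono)
    then show "(r - a) div n \<noteq> (s - a) div n" using assms by simp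
  qed
  moreover have "(\<lambda>r. (r - a) div n) ` ?R \<subseteq> {..(l - 1) div n}"
    by (auto intro!: div_le_mono)
  ultimately have "card ?R \<le> card {..(l - 1) div n}"
    by (rule card_inj_on_le) simp
  then show ?thesis by simp
qed

lemma card_residue_window_real:
  fixes a l n :: nat
  assumes "n > 0"
  shows "real (card {r \<in> {a..<a + l}. r mod n = c}) \<le> l / n + 1"
proof -
  have "real ((l - 1) div n) \<le> real (l - 1) / n" by (rule of_nat_div_le_of_nat)
  also have "\<dots> \<le> l / n" by (simp add: divide_right_mono)
  finally show ?thesis using card_residue_window[OF assms, of a l c] by linarith
qed

text \<open>The choice depends on the set alone, so all nodes that know a set agree on its numbering
  without communication.\<close>

definition enumeration :: "'a set \<Rightarrow> 'a \<Rightarrow> nat" where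
  "enumeration A = (SOME h. bij_betw h A {..<card A})"

lemma bij_betw_enumeration: "finite A \<Longrightarrow> bij_betw (enumeration A) A {..<card A}"
  unfolding enumeration_def lessThan_atLeast0
  by (rule someI_ex[of "\<lambda>h. bij_betw h A {0..<card A}"]) (rule ex_bij_betw_finite_nat)

lemma card_enumeration_mod:
  assumes "finite A" "N > 0"
  shows "real (card {x \<in> A. enumeration A x mod N = c}) \<le> card A / N + 1"
proof -
  note b = bij_betw_enumeration[OF assms(1)]
  have "inj_on (enumeration A) {x \<in> A. enumeration A x mod N = c}"
    by (rule inj_on_subset[OF bij_betw_imp_inj_on[OF b]]) blast
  moreover have "enumeration A ` {x \<in> A. enumeration A x mod N = c} \<subseteq> {r \<in> {0..<0 + card A}. r mod N = c}"
    using bij_betwE[OF b] by auto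
  ultimately have "card {x \<in> A. enumeration A x mod N = c} \<le> card {r \<in> {0..<0 + card A}. r mod N = c}"
    by (rule card_inj_on_le) simp
  then show ?thesis using card_residue_window_real[OF assms(2), of 0 "card A" c] by linarith
qed

section \<open>Cutting a vertex set into intervals of nearly equal weight\<close>

text \<open>\<open>seg V f N a\<close> collects the vertices whose preceding weight lies in the \<open>a\<close>-th of \<open>N\<close> equal
  slices of the total weight.\<close>

definition seg :: "nat set \<Rightarrow> (nat \<Rightarrow> real) \<Rightarrow> nat \<Rightarrow> nat \<Rightarrow> nat set" where
  "seg V f N a = {v \<in> V. nat \<lfloor>N * sum f {u \<in> V. u < v} / sum f V\<rfloor> = a}"

definition interval_in :: "nat set \<Rightarrow> nat set \<Rightarrow> bool" where
  "interval_in V S \<longleftrightarrow> S \<subseteq> V \<and> (\<forall>x \<in> S. \<forall>z \<in> S. \<forall>y \<in> V. x \<le> y \<longrightarrow> y \<le> z \<longrightarrow> y \<in> S)"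

lemma seg_subset: "seg V f N a \<subseteq> V"
  by (auto simp: seg_def)

lemma seg_disjoint: "v \<in> seg V f N a \<Longrightarrow> v \<in> seg V f N b \<Longrightarrow> a = b"
  by (auto simp: seg_def)

lemma seg_cong: "(\<And>v. v \<in> V \<Longrightarrow> f v = g v) \<Longrightarrow> seg V f N a = seg V g N a"
proof -
  assume e: "\<And>v. v \<in> V \<Longrightarrow> f v = g v"
  have "sum f {u \<in> V. u < x} = sum g {u \<in> V. u < x}" "sum f V = sum g V" for x
    using e by (auto intro: sum.cong)
  then show ?thesis by (simp add: seg_def)
qed

lemma sum_before_mono:
  fixes f :: "nat \<Rightarrow> real"
  assumes "finite V" "\<And>v. v \<in> V \<Longrightarrow> f v \<ge> 0" "x \<le> y"
  shows "sum f {u \<in> V. u < x} \<le> sum f {u \<in> V. u < y}"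
  using assms by (intro sum_mono2) auto

lemma interval_in_seg:
  assumes "finite V" "\<And>v. v \<in> V \<Longrightarrow> f v \<ge> 0"
  shows "interval_in V (seg V f N a)"
proof -
  have m: "nat \<lfloor>N * sum f {u \<in> V. u < x} / sum f V\<rfloor> \<le> nat \<lfloor>N * sum f {u \<in> V. u < y} / sum f V\<rfloor>"
    if "x \<le> y" for x y
    using sum_before_mono[OF assms that] assms(2)
    by (intro nat_mono floor_mono divide_right_mono mult_left_mono sum_nonneg) auto
  show ?thesis unfolding interval_in_def seg_def
  proof (intro conjI ballI impI)
    fix x y z
    assume "x \<in> {v \<in> V. nat \<lfloor>N * sum f {u \<in> V. u < v} / sum f V\<rfloor> = a}"
      "z \<in> {v \<in> V. nat \<lfloor>N * sum f {u \<in> V. u < v} / sum f V\<rfloor> = a}"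
      and y: "y \<in> V" "x \<le> y" "y \<le> z"
    then show "y \<in> {v \<in> V. nat \<lfloor>N * sum f {u \<in> V. u < v} / sum f V\<rfloor> = a}"
      using m[OF y(2)] m[OF y(3)] by simp
  qed blast
qed

text \<open>Strict positivity keeps the weight before \<open>v\<close> strictly below the total, so
  the index of the slice is below \<open>N\<close>.\<close>

lemma seg_cover:
  assumes "finite V" "\<And>v. v \<in> V \<Longrightarrow> f v > 0" "N > 0" "v \<in> V"
  shows "\<exists>a < N. v \<in> seg V f N a"
proof -
  have pos: "sum f V > 0" using assms by (intro sum_pos) auto
  have "sum f {u \<in> V. u < v} + f v = sum f (insert v {u \<in> V. u < v})"
    using assms(1) by (subst sum.insert) auto
  also have "\<dots> \<le> sum f V"
    using assms by (intro sum_mono2) (auto intro: less_imp_le)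
  finally have "sum f {u \<in> V. u < v} < sum f V" using assms(2)[OF assms(4)] by linarith
  then have "N * sum f {u \<in> V. u < v} / sum f V < N" using pos assms(3) by (simp add: field_simps)
  then have "nat \<lfloor>N * sum f {u \<in> V. u < v} / sum f V\<rfloor> < N" using assms(3) by linarith
  then show ?thesis using assms(4) by (auto simp: seg_def)
qed

lemma sum_interval_in:
  fixes f :: "nat \<Rightarrow> 'b :: ab_group_add"
  assumes "finite V" "interval_in V S" "S \<noteq> {}"
  shows "sum f S = sum f {u \<in> V. u < Max S} + f (Max S) - sum f {u \<in> V. u < Min S}"
proof -
  have SV: "S \<subseteq> V" using assms by (auto simp: interval_in_def)
  have fS: "finite S" using SV assms(1) by (rule finite_subset)
  have M: "Max S \<in> S" "Min S \<in> S" "\<And>x. x \<in> S \<Longrightarrow> Min S \<le> x \<and> x \<le> Max S"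
    using fS assms(3) by auto
  have "S \<union> {u \<in> V. u < Min S} = insert (Max S) {u \<in> V. u < Max S}"
  proof (intro equalityI subsetI)
    fix x assume "x \<in> S \<union> {u \<in> V. u < Min S}"
    then show "x \<in> insert (Max S) {u \<in> V. u < Max S}"
      using M SV by (metis (mono_tags, lifting) Un_iff insert_iff mem_Collect_eq order_le_less order_less_le_trans subsetD)
  next
    fix x assume "x \<in> insert (Max S) {u \<in> V. u < Max S}"
    then show "x \<in> S \<union> {u \<in> V. u < Min S}"
      using M assms(2) unfolding interval_in_def
      by (metis (mono_tags, lifting) UnI1 UnI2 insert_iff less_imp_le mem_Collect_eq not_le)
  qed
  moreover have "S \<inter> {u \<in> V. u < Min S} = {}" using M by auto (meson not_le)
  ultimately have "sum f S + sum f {u \<in> V. u < Min S} = sum f (insert (Max S) {u \<in> V. u < Max S})"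
    using fS assms(1) by (metis (no_types, lifting) finite_Collect_conjI sum.union_disjoint finite.emptyI
      finite_subset mem_Collect_eq subsetI)
  also have "\<dots> = f (Max S) + sum f {u \<in> V. u < Max S}"
    using assms(1) by (subst sum.insert) auto
  finally show ?thesis by (simp add: algebra_simps)
qed

text \<open>The weights preceding the first and the last vertex of a segment lie in the same slice
  and differ by at most \<open>sum f V / N\<close>; the last vertex itself adds at most
  \<open>B\<close>.\<close>

lemma sum_seg_le:
  assumes "finite V" "\<And>v. v \<in> V \<Longrightarrow> f v > 0" "\<And>v. v \<in> V \<Longrightarrow> f v \<le> B" "N > 0" "B \<ge> 0"
  shows "sum f (seg V f N a) \<le> sum f V / N + B"
proof (cases "seg V f N a = {}")
  case True
  then show ?thesis using assms by (simp add: sum_nonneg less_imp_le)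
next
  case False
  let ?S = "seg V f N a" and ?F = "\<lambda>x. sum f {u \<in> V. u < x}"
  have I: "interval_in V ?S" using assms by (intro interval_in_seg) (auto intro: less_imp_le)
  have fS: "finite ?S" using assms(1) seg_subset by (metis finite_subset)
  have pos: "sum f V > 0" using assms False seg_subset[of V f N a] by (intro sum_pos) auto
  have MM: "Max ?S \<in> ?S" "Min ?S \<in> ?S" using fS False by auto
  have F0: "?F x \<ge> 0" for x using assms(2) by (intro sum_nonneg) (auto intro: less_imp_le)
  have nn: "N * ?F x / sum f V \<ge> 0" for x using pos F0 by (intro divide_nonneg_nonneg mult_nonneg_nonneg) auto
  have "N * ?F (Max ?S) / sum f V < a + 1" "N * ?F (Min ?S) / sum f V \<ge> a"
    using MM nn[of "Max ?S"] nn[of "Min ?S"] unfolding seg_def mem_Collect_eq by linarith+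
  then have "?F (Max ?S) < (a + 1) * sum f V / N" "?F (Min ?S) \<ge> a * sum f V / N"
    using pos assms(4) by (simp_all add: field_simps)
  then have "?F (Max ?S) - ?F (Min ?S) \<le> sum f V / N" by (simp add: add_divide_distrib ring_distribs)
  moreover have "f (Max ?S) \<le> B" using MM assms(3) seg_subset by blast
  ultimately show ?thesis using sum_interval_in[OF assms(1) I False, of f] by linarith
qed

text \<open>A nonempty interval is determined by its minimum and maximum. This count is what lets an
  interval fit into a single message.\<close>

lemma card_intervals_le:
  assumes "finite V"
  shows "finite {S. interval_in V S} \<and> card {S. interval_in V S} \<le> card V ^ 2 + 1"
proof -
  let ?g = "\<lambda>(a, b). {v \<in> V. a \<le> v \<and> v \<le> b}"
  have sub: "{S. interval_in V S} \<subseteq> insert {} (?g ` (V \<times> V))"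
  proof
    fix S assume "S \<in> {S. interval_in V S}"
    then have S: "interval_in V S" by simp
    then have SV: "S \<subseteq> V" by (auto simp: interval_in_def)
    have fS: "finite S" using SV assms by (rule finite_subset)
    show "S \<in> insert {} (?g ` (V \<times> V))"
    proof (cases "S = {}")
      case False
      then have MM: "Max S \<in> S" "Min S \<in> S" using fS by auto
      have "x \<in> S \<longleftrightarrow> x \<in> V \<and> Min S \<le> x \<and> x \<le> Max S" for x
        using S MM SV Min_le[OF fS, of x] Max_ge[OF fS, of x] unfolding interval_in_def by blast
      then have "S = ?g (Min S, Max S)" by auto
      moreover have "(Min S, Max S) \<in> V \<times> V" using MM SV by auto
      ultimately show ?thesis by blast
    qed simp
  qed
  have fin: "finite (insert {} (?g ` (V \<times> V)))" using assms by simp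
  have "card (insert {} (?g ` (V \<times> V))) \<le> Suc (card (?g ` (V \<times> V)))" by (rule card_insert_le_m1) auto
  also have "\<dots> \<le> Suc (card (V \<times> V))" using assms card_image_le[of "V \<times> V" ?g] by simp
  finally have "card (insert {} (?g ` (V \<times> V))) \<le> card V ^ 2 + 1"
    by (simp add: card_cartesian_product power2_eq_square)
  then show ?thesis using card_mono[OF fin sub] finite_subset[OF sub fin] by linarith
qed

subsection \<open>Protocols as evolution of knowledge\<close>

text \<open>The state of a protocol is the information of each node, represented by its indistinguishability
  relation: \<open>E v G G'\<close> means that \<open>v\<close> has seen the same on the input graphs \<open>G\<close> and \<open>G'\<close>.\<close>

type_synonym knowledge = "nat \<Rightarrow> ugraph \<Rightarrow> ugraph \<Rightarrow> bool"

locale clique_network =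
  fixes V :: "nat set" and Gs :: "ugraph set" and b :: nat and E0 :: knowledge
begin

definition knows :: "knowledge \<Rightarrow> nat \<Rightarrow> (ugraph \<Rightarrow> 'a) \<Rightarrow> bool" where
  "knows E u f \<longleftrightarrow> (\<forall>G \<in> Gs. \<forall>G' \<in> Gs. E u G G' \<longrightarrow> f G = f G')"

text \<open>Messages are functions of the whole input graph; \<open>knows\<close> ensures that the
  sender can compute them. A larger relation means less knowledge, and both rules allow the new
  relation to be coarser than what was actually seen, so that information may be forgotten.\<close>

inductive reach :: "nat \<Rightarrow> knowledge \<Rightarrow> bool" where
  start: "(\<And>v G G'. v \<in> V \<Longrightarrow> G \<in> Gs \<Longrightarrow> G' \<in> Gs \<Longrightarrow> E0 v G G' \<Longrightarrow> E v G G') \<Longrightarrow> reach 0 E"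
| round: "reach t E \<Longrightarrow> (\<And>u v. u \<in> V \<Longrightarrow> v \<in> V \<Longrightarrow> knows E u (F u v)) \<Longrightarrow>
    (\<And>u v G. u \<in> V \<Longrightarrow> v \<in> V \<Longrightarrow> G \<in> Gs \<Longrightarrow> length (F u v G :: message) \<le> b) \<Longrightarrow>
    (\<And>v G G'. v \<in> V \<Longrightarrow> G \<in> Gs \<Longrightarrow> G' \<in> Gs \<Longrightarrow> E v G G' \<Longrightarrow>
       (\<And>u. u \<in> V \<Longrightarrow> u \<noteq> v \<Longrightarrow> F u v G = F u v G') \<Longrightarrow> E' v G G') \<Longrightarrow> reach (Suc t) E'"

definition view_eq :: "(nat \<Rightarrow> nat \<Rightarrow> nat \<Rightarrow> ugraph \<Rightarrow> message) \<Rightarrow> nat \<Rightarrow> knowledge" where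
  "view_eq F r v G G' \<longleftrightarrow> E0 v G G' \<and> (\<forall>s < r. \<forall>u \<in> V. u \<noteq> v \<longrightarrow> F s u v G = F s u v G')"

lemma view_eq_cong: "(\<And>s. s < r \<Longrightarrow> F s = F' s) \<Longrightarrow> view_eq F r = view_eq F' r"
  by (simp add: view_eq_def fun_eq_iff)

lemma reach_mono:
  assumes "reach t E" "\<And>v G G'. v \<in> V \<Longrightarrow> G \<in> Gs \<Longrightarrow> G' \<in> Gs \<Longrightarrow> E v G G' \<Longrightarrow> E' v G G'"
  shows "reach t E'"
  using assms(1)
proof cases
  case start
  show ?thesis unfolding start(1) by (rule reach.start) (rule assms(2)[OF _ _ _ start(2)])
next
  case (round s D F)
  show ?thesis unfolding round(1)
    by (rule reach.round[where F = F, OF round(2-4)]) (simp_all add: round(5) assms(2))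
qed

text \<open>Turns the inductive derivation into one explicit schedule. The full transcript is at
  least as fine as \<open>E\<close>, hence a message known under \<open>E\<close> is known under the
  transcript; appending round \<open>t\<close> does not affect the views of earlier rounds.\<close>

lemma reach_schedule:
  assumes "reach t E"
  shows "\<exists>F. (\<forall>r < t. \<forall>u \<in> V. \<forall>v \<in> V. knows (view_eq F r) u (F r u v) \<and>
      (\<forall>G \<in> Gs. length (F r u v G) \<le> b)) \<and>
    (\<forall>v \<in> V. \<forall>G \<in> Gs. \<forall>G' \<in> Gs. view_eq F t v G G' \<longrightarrow> E v G G')"
  using assms
proof induction
  case (start E)
  then show ?case by (auto simp: view_eq_def)
next
  case (round t E F E')
  then obtain F' where F': "\<forall>r < t. \<forall>u \<in> V. \<forall>v \<in> V. knows (view_eq F' r) u (F' r u v) \<and>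
      (\<forall>G \<in> Gs. length (F' r u v G) \<le> b)"
    "\<forall>v \<in> V. \<forall>G \<in> Gs. \<forall>G' \<in> Gs. view_eq F' t v G G' \<longrightarrow> E v G G'" by blast
  define F2 where "F2 = F'(t := F)"
  have v: "view_eq F2 r = view_eq F' r" if "r \<le> t" for r
    using that by (intro view_eq_cong) (simp add: F2_def)
  have "knows (view_eq F2 r) u (F2 r u v) \<and> (\<forall>G \<in> Gs. length (F2 r u v G) \<le> b)"
    if "r < Suc t" "u \<in> V" "v \<in> V" for r u v
  proof (cases "r = t")
    case True
    have "F u v G = F u v G'" if "G \<in> Gs" "G' \<in> Gs" "view_eq F' t u G G'" for G G'
      using round.hyps(2)[OF \<open>u \<in> V\<close> \<open>v \<in> V\<close>] F'(2) \<open>u \<in> V\<close> that unfolding knows_def by blast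
    then show ?thesis using True round.hyps(3) that v[of t] by (simp add: knows_def F2_def)
  next
    case False
    then show ?thesis using F'(1) that v[of r] by (simp add: F2_def)
  qed
  moreover have "E' v G G'" if "v \<in> V" "G \<in> Gs" "G' \<in> Gs" "view_eq F2 (Suc t) v G G'" for v G G'
  proof (rule round.hyps(4)[OF that(1-3)])
    have "view_eq F2 t v G G'" using that(4) by (simp add: view_eq_def)
    then show "E v G G'" using v[of t] F'(2) that by simp
    show "F u v G = F u v G'" if "u \<in> V" "u \<noteq> v" for u
      using that \<open>view_eq F2 (Suc t) v G G'\<close> by (auto simp: view_eq_def F2_def)
  qed
  ultimately show ?case by blast
qed

section \<open>Encoding of messages and transmission of sets\<close>

text \<open>The strings of length exactly \<open>b\<close> serve as codes. Outside \<open>X\<close>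
  the empty message is used, so the length bound needs no membership assumption.\<close>

lemma message_code_exists:
  assumes "finite X" "card X \<le> 2 ^ b"
  shows "\<exists>enc :: 'a \<Rightarrow> message. inj_on enc X \<and> (\<forall>x. length (enc x) \<le> b)"
proof -
  let ?Y = "{xs :: bool list. set xs \<subseteq> UNIV \<and> length xs = b}"
  have "card ?Y = 2 ^ b" "finite ?Y"
    using card_lists_length_eq[of "UNIV :: bool set" b] finite_lists_length_eq[of "UNIV :: bool set" b]
    by auto
  then obtain enc where enc: "inj_on enc X" "enc ` X \<subseteq> ?Y"
    using assms card_le_inj[of X ?Y] by auto
  have "inj_on (\<lambda>x. if x \<in> X then enc x else []) X" using enc(1) by (simp add: inj_on_def)
  then show ?thesis
    using enc(2) by (intro exI[of _ "\<lambda>x. if x \<in> X then enc x else []"]) auto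
qed

text \<open>Hides the bit encoding. In \<open>learn\<close> the receiver may also use its message to
  itself: the model does not deliver it, but \<open>v\<close> can compute it.\<close>

lemma reach_send:
  fixes f :: "nat \<Rightarrow> nat \<Rightarrow> ugraph \<Rightarrow> 'a"
  assumes "reach t E" "finite X" "card X \<le> 2 ^ b"
    and know: "\<And>u v. u \<in> V \<Longrightarrow> v \<in> V \<Longrightarrow> knows E u (f u v)"
    and range: "\<And>u v G. u \<in> V \<Longrightarrow> v \<in> V \<Longrightarrow> G \<in> Gs \<Longrightarrow> f u v G \<in> X"
    and learn: "\<And>v G G'. v \<in> V \<Longrightarrow> G \<in> Gs \<Longrightarrow> G' \<in> Gs \<Longrightarrow> E v G G' \<Longrightarrow>
       (\<And>u. u \<in> V \<Longrightarrow> f u v G = f u v G') \<Longrightarrow> E' v G G'"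
  shows "reach (Suc t) E'"
proof -
  obtain enc :: "'a \<Rightarrow> message" where enc: "inj_on enc X" "\<forall>x. length (enc x) \<le> b"
    using message_code_exists[OF assms(2,3)] by blast
  show ?thesis
  proof (rule reach.round[OF assms(1), where F = "\<lambda>u v G. enc (f u v G)"])
    show "knows E u (\<lambda>G. enc (f u v G))" if "u \<in> V" "v \<in> V" for u v
      using know[OF that] unfolding knows_def by metis
    fix v G G'
    assume v: "v \<in> V" and G: "G \<in> Gs" "G' \<in> Gs" and E: "E v G G'"
      and eq: "\<And>u. u \<in> V \<Longrightarrow> u \<noteq> v \<Longrightarrow> enc (f u v G) = enc (f u v G')"
    have "f u v G = f u v G'" if "u \<in> V" for u
    proof (cases "u = v")
      case True
      then show ?thesis using know[OF v v] G E by (simp add: knows_def)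
    next
      case False
      then show ?thesis using eq[OF that] range[OF that v] G enc(1) by (simp add: inj_on_eq_iff)
    qed
    then show "E' v G G'" by (rule learn[OF v G E])
  qed (use enc in auto)
qed

definition nth_element :: "nat \<Rightarrow> 'a set \<Rightarrow> 'a option" where
  "nth_element i A = (if \<exists>x \<in> A. enumeration A x = i then Some (SOME x. x \<in> A \<and> enumeration A x = i) else None)"

lemma nth_element_mem: "nth_element i A = Some x \<Longrightarrow> x \<in> A"
  unfolding nth_element_def
  by (metis (mono_tags, lifting) option.distinct(1) option.inject someI_ex)

lemma nth_element_enumeration:
  assumes "finite A" "x \<in> A"
  shows "enumeration A x < card A" "nth_element (enumeration A x) A = Some x"
proof -
  note b = bij_betw_enumeration[OF assms(1)]
  show "enumeration A x < card A" using bij_betwE[OF b] assms by blast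
  have "(SOME y. y \<in> A \<and> enumeration A y = enumeration A x) = x"
    using assms bij_betw_imp_inj_on[OF b] by (intro some_equality) (auto simp: inj_on_def)
  then show "nth_element (enumeration A x) A = Some x" using assms by (auto simp: nth_element_def)
qed

lemma set_eq_nth_elementsI:
  assumes "finite A" "card A \<le> L" "finite B" "card B \<le> L"
    and eq: "\<And>i. i < L \<Longrightarrow> nth_element i A = nth_element i B"
  shows "A = B"
proof -
  have "x \<in> A \<longleftrightarrow> (\<exists>i < L. nth_element i A = Some x)" "x \<in> B \<longleftrightarrow> (\<exists>i < L. nth_element i B = Some x)" for x
    using nth_element_enumeration[OF assms(1), of x] nth_element_enumeration[OF assms(3), of x]
      nth_element_mem assms(2,4) by (metis order_less_le_trans)+
  then show ?thesis using eq by (intro set_eqI) (metis (full_types))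
qed

text \<open>The elements are sent one per round in the order of \<open>enumeration\<close>.
  \<open>None\<close> signals that the set is exhausted and accounts for the additional
  code.\<close>

lemma reach_send_set:
  fixes f :: "nat \<Rightarrow> nat \<Rightarrow> ugraph \<Rightarrow> 'a set"
  assumes "reach t E" "finite X" "card X + 1 \<le> 2 ^ b"
    and know: "\<And>u v. u \<in> V \<Longrightarrow> v \<in> V \<Longrightarrow> knows E u (f u v)"
    and range: "\<And>u v G. u \<in> V \<Longrightarrow> v \<in> V \<Longrightarrow> G \<in> Gs \<Longrightarrow> f u v G \<subseteq> X \<and> card (f u v G) \<le> L"
    and learn: "\<And>v G G'. v \<in> V \<Longrightarrow> G \<in> Gs \<Longrightarrow> G' \<in> Gs \<Longrightarrow> E v G G' \<Longrightarrow>
       (\<And>u. u \<in> V \<Longrightarrow> f u v G = f u v G') \<Longrightarrow> E' v G G'"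
  shows "reach (t + L) E'"
proof -
  define K where "K l v G G' \<longleftrightarrow> E v G G' \<and> (\<forall>u \<in> V. \<forall>i < l. nth_element i (f u v G) = nth_element i (f u v G'))"
    for l :: nat and v G G'
  let ?X = "insert None (Some ` X)"
  have X: "finite ?X" "card ?X \<le> 2 ^ b"
    using assms(2,3) by (auto simp: card_image card_insert_if)
  have K: "reach (t + l) (K l)" for l
  proof (induction l)
    case 0
    have "K 0 = E" by (simp add: K_def fun_eq_iff)
    then show ?case using assms(1) by simp
  next
    case (Suc l)
    have "reach (Suc (t + l)) (K (Suc l))"
    proof (rule reach_send[OF Suc X, where f = "\<lambda>u v G. nth_element l (f u v G)"])
      show "knows (K l) u (\<lambda>G. nth_element l (f u v G))" if "u \<in> V" "v \<in> V" for u v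
        using know[OF that] unfolding knows_def K_def by metis
      show "nth_element l (f u v G) \<in> ?X" if "u \<in> V" "v \<in> V" "G \<in> Gs" for u v G
        using range[OF that] nth_element_mem[of l "f u v G"]
        by (cases "nth_element l (f u v G)") auto
    qed (auto simp: K_def less_Suc_eq)
    then show ?case by simp
  qed
  have E': "E' v G G'" if "v \<in> V" "G \<in> Gs" "G' \<in> Gs" "K L v G G'" for v G G'
  proof (rule learn[OF that(1-3)])
    show "E v G G'" using that(4) by (simp add: K_def)
    show "f u v G = f u v G'" if "u \<in> V" for u
      using range[OF that \<open>v \<in> V\<close>] \<open>G \<in> Gs\<close> \<open>G' \<in> Gs\<close> \<open>K L v G G'\<close> assms(2) that
      by (intro set_eq_nth_elementsI[where L = L]) (auto simp: K_def dest: finite_subset)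
  qed
  show ?thesis using K E' by (rule reach_mono)
qed

end

section \<open>From protocols for a fixed number of edges to one algorithm\<close>

lemma sum_degrees:
  assumes "simple_graph G" "verts G = V"
  shows "(\<Sum>v \<in> V. card (incident G v)) = 2 * card (edges G)"
proof -
  have fV: "finite V" and e: "\<And>e. e \<in> edges G \<Longrightarrow> e \<subseteq> V \<and> card e = 2"
    using assms by (auto simp: simple_graph_def)
  have fe: "finite (edges G)" using e fV by (intro finite_subset[of "edges G" "Pow V"]) auto
  have "(\<Sum>v \<in> V. card (incident G v)) = (\<Sum>v \<in> V. \<Sum>e \<in> edges G. of_bool (v \<in> e))"
    using fe by (simp add: incident_def of_bool_def sum.If_cases Int_def)
  also have "\<dots> = (\<Sum>e \<in> edges G. \<Sum>v \<in> V. of_bool (v \<in> e))" by (rule sum.swap)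
  also have "\<dots> = (\<Sum>e \<in> edges G. 2)"
  proof (rule sum.cong[OF refl])
    fix e assume "e \<in> edges G"
    then have "V \<inter> e = e" "card e = 2" using e by auto
    then show "(\<Sum>v \<in> V. of_bool (v \<in> e)) = (2 :: nat)"
      using fV by (simp add: of_bool_def sum.If_cases)
  qed
  finally show ?thesis by simp
qed

definition graphs_on :: "nat set \<Rightarrow> nat \<Rightarrow> ugraph set" where
  "graphs_on V m = {G. simple_graph G \<and> verts G = V \<and> card (edges G) = m}"

definition local_degrees_eq :: "nat set \<Rightarrow> knowledge" where
  "local_degrees_eq V v G G' \<longleftrightarrow> incident G v = incident G' v \<and>
     (\<forall>u \<in> V. card (incident G u) = card (incident G' u))"

text \<open>A protocol for every number of edges yields one algorithm, because a preliminary round in which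
  the nodes exchange their degrees tells everybody the number of edges. Since messages and outputs
  are determined by views, the algorithm can simulate the protocol on any graph consistent with its
  view.\<close>

lemma algorithm_of_protocols:
  fixes T :: "nat \<Rightarrow> nat" and E :: "nat \<Rightarrow> knowledge" and out :: "nat \<Rightarrow> ugraph \<Rightarrow> ugraph set"
  assumes V: "finite V" "2 * card V ^ 2 + 1 \<le> 2 ^ b"
    and reach: "\<And>m. clique_network.reach V (graphs_on V m) b (local_degrees_eq V) (T m) (E m)"
    and out: "\<And>m v. v \<in> V \<Longrightarrow> clique_network.knows (graphs_on V m) (E m) v (out v)"
  shows "\<exists>A. \<forall>m. \<forall>G \<in> graphs_on V m.
      (\<forall>r. \<forall>u \<in> V. \<forall>v \<in> V. length (transmitted A u (incident G u) (history A G r u) v) \<le> b) \<and>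
      (\<forall>v \<in> V. halted A v (incident G v) (history A G (Suc (T m)) v)) \<and>
      (\<forall>v \<in> V. node_output A G v = out v G)"
proof -
  let ?knows = "\<lambda>m. clique_network.knows (graphs_on V m)"
  let ?view = "clique_network.view_eq V (local_degrees_eq V)"
  define P where "P m F \<longleftrightarrow> (\<forall>r < T m. \<forall>u \<in> V. \<forall>v \<in> V. ?knows m (?view F r) u (F r u v) \<and>
      (\<forall>G \<in> graphs_on V m. length (F r u v G) \<le> b)) \<and>
    (\<forall>v \<in> V. \<forall>G \<in> graphs_on V m. \<forall>G' \<in> graphs_on V m. ?view F (T m) v G G' \<longrightarrow> E m v G G')" for m F
  have "\<exists>F. P m F" for m
    unfolding P_def by (rule clique_network.reach_schedule[OF reach])
  then obtain F where "\<And>m. P m (F m)" by metis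
  then have F: "\<And>m r u v. r < T m \<Longrightarrow> u \<in> V \<Longrightarrow> v \<in> V \<Longrightarrow> ?knows m (?view (F m) r) u (F m r u v)"
     "\<And>m r u v G. r < T m \<Longrightarrow> u \<in> V \<Longrightarrow> v \<in> V \<Longrightarrow> G \<in> graphs_on V m \<Longrightarrow> length (F m r u v G) \<le> b"
     "\<And>m v G G'. v \<in> V \<Longrightarrow> G \<in> graphs_on V m \<Longrightarrow> G' \<in> graphs_on V m \<Longrightarrow> ?view (F m) (T m) v G G' \<Longrightarrow> E m v G G'"
    by (simp_all add: P_def)
  obtain enc :: "nat \<Rightarrow> message" where enc: "inj_on enc {..2 * card V ^ 2}" "\<forall>x. length (enc x) \<le> b"
    using clique_network.message_code_exists[of "{..2 * card V ^ 2}" b] V(2) by auto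
  define All where "All = {G. simple_graph G \<and> verts G = V}"
  let ?m = "\<lambda>G. card (edges G)"
  have All: "G \<in> graphs_on V (?m G)" if "G \<in> All" for G
    using that by (simp add: All_def graphs_on_def)
  have deg_le: "card (incident G v) \<le> 2 * card V ^ 2" if "G \<in> All" "v \<in> V" for G v
  proof -
    have sg: "simple_graph G" and vG: "verts G = V" using that by (auto simp: All_def)
    have "edges G \<subseteq> (\<lambda>(a, b). {a, b}) ` (V \<times> V)"
    proof
      fix e assume "e \<in> edges G"
      then have e: "e \<subseteq> V" "card e = 2" using sg vG by (auto simp: simple_graph_def)
      then obtain a b where "e = {a, b}" by (auto simp: card_2_iff)
      then show "e \<in> (\<lambda>(a, b). {a, b}) ` (V \<times> V)" using e by auto
    qed
    then have "card (edges G) \<le> card (V \<times> V)" using V(1) by (intro surj_card_le) auto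
    moreover have "card (incident G v) \<le> (\<Sum>v \<in> V. card (incident G v))"
      using that V(1) by (intro member_le_sum) auto
    ultimately show ?thesis
      using sum_degrees[OF sg vG] by (simp add: card_cartesian_product power2_eq_square)
  qed
  \<comment> \<open>Round 0 announces degrees, so the protocol is shifted by one round; afterwards
    there is silence. \<open>hist\<close> is the intended history, defined without reference to the
    algorithm in order to avoid a circular definition.\<close>
  define msg where "msg r G u v = (if r = 0 then enc (card (incident G u))
    else if r \<le> T (?m G) then F (?m G) (r - 1) u v G else [])" for r G u v
  define hist where "hist r G v = map (\<lambda>s u. if u \<in> V \<and> u \<noteq> v then msg s G u v else []) [0..<r]" for r G v
  have hist_simps: "hist 0 G v = []" "length (hist r G v) = r"
     "hist (Suc r) G v = hist r G v @ [\<lambda>u. if u \<in> V \<and> u \<noteq> v then msg r G u v else []]" for r G v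
    by (simp_all add: hist_def)
  have take_hist: "take s (hist r G v) = hist s G v" if "s \<le> r" for s r G v
    using that by (simp add: hist_def take_map)
  \<comment> \<open>The core of the simulation: the view determines the next messages and, at the
    end, the output. The number of edges is determined only after round 0, hence
    \<open>r > 0\<close>.\<close>
  have same: "r > 0 \<longrightarrow> ?m G = ?m G'" "\<forall>u \<in> V. msg r G v u = msg r G' v u" "T (?m G) < r \<longrightarrow> out v G = out v G'"
    if G: "G \<in> All" "G' \<in> All" and v: "v \<in> V" and I: "incident G v = incident G' v"
      and h: "hist r G v = hist r G' v" for r G G' v
  proof -
    have m: "msg s G u v = msg s G' u v" if "s < r" "u \<in> V" "u \<noteq> v" for s u
    proof -
      have "(hist r G v ! s) u = (hist r G' v ! s) u" using h by simp
      then show ?thesis using that by (simp add: hist_def)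
    qed
    have deg: "card (incident G u) = card (incident G' u)" if "r > 0" "u \<in> V" for u
      using m[of 0 u] I that deg_le G enc(1) by (cases "u = v") (auto simp: msg_def inj_on_eq_iff)
    show meq: "r > 0 \<longrightarrow> ?m G = ?m G'"
    proof
      assume "r > 0"
      then have "(\<Sum>v \<in> V. card (incident G v)) = (\<Sum>v \<in> V. card (incident G' v))" using deg by simp
      then show "?m G = ?m G'" using sum_degrees[of G V] sum_degrees[of G' V] G by (simp add: All_def)
    qed
    have view: "?view (F (?m G)) s v G G'" if "s < r" "s \<le> T (?m G)" for s
      unfolding clique_network.view_eq_def local_degrees_eq_def
    proof (intro conjI allI impI ballI)
      fix s' u assume s': "s' < s" and u: "u \<in> V" "u \<noteq> v"
      then have "Suc s' < r" "Suc s' \<le> T (?m G)" using that by linarith+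
      then show "F (?m G) s' u v G = F (?m G) s' u v G'"
        using m[of "Suc s'" u] u meq that by (simp add: msg_def)
    qed (use I deg that in auto)
    show "\<forall>u \<in> V. msg r G v u = msg r G' v u"
    proof
      fix u assume u: "u \<in> V"
      show "msg r G v u = msg r G' v u"
      proof (cases "r = 0 \<or> r > T (?m G)")
        case True
        then show ?thesis using meq I by (auto simp: msg_def)
      next
        case False
        have "F (?m G) (r - 1) v u G = F (?m G) (r - 1) v u G'"
        proof -
          have r: "r - 1 < T (?m G)" "r - 1 < r" "r - 1 \<le> T (?m G)" using False by auto
          have "G' \<in> graphs_on V (?m G)" using All[OF G(2)] meq False by simp
          then show ?thesis
            using F(1)[OF r(1) v u] view[OF r(2,3)] All[OF G(1)] unfolding clique_network.knows_def by blast
        qed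
        then show ?thesis using False meq by (simp add: msg_def)
      qed
    qed
    show "T (?m G) < r \<longrightarrow> out v G = out v G'"
    proof
      assume r: "T (?m G) < r"
      then have "?m G = ?m G'" using meq by simp
      then have "E (?m G) v G G'"
        using F(3)[OF v All[OF G(1)]] All[OF G(2)] view[OF r] by simp
      then show "out v G = out v G'"
        using out[OF v, of "?m G"] All[OF G(1)] All[OF G(2)] \<open>?m G = ?m G'\<close>
        by (simp add: clique_network.knows_def)
    qed
  qed
  define guess where "guess v I h = (SOME G. G \<in> All \<and> incident G v = I \<and> hist (length h) G v = h)" for v I h
  have guess: "guess v (incident G v) (hist r G v) \<in> All \<and>
      incident (guess v (incident G v) (hist r G v)) v = incident G v \<and>
      hist r (guess v (incident G v) (hist r G v)) v = hist r G v" if "G \<in> All" for G v r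
    unfolding guess_def hist_simps(2) by (rule someI[of _ G]) (use that in simp)
  \<comment> \<open>In the empty view the guessed graph may have a wrong number of edges. This is
    harmless: nobody decides at length 0, and the first message depends on the incident edges
    only.\<close>
  define A where "A = \<lparr>send = (\<lambda>v I h u. msg (length h) (guess v I h) v u),
    decide = (\<lambda>v I h. if length h = Suc (T (?m (guess v I h))) then Some (out v (guess v I h)) else None)\<rparr>"
  have decide: "decide A v (incident G v) (hist r G v) = (if r = Suc (T (?m G)) then Some (out v G) else None)"
    if "G \<in> All" "v \<in> V" for G v r
    using same[of "guess v (incident G v) (hist r G v)" G v r] guess[OF that(1), of v r] that
    by (cases "r = 0") (auto simp: A_def hist_simps)
  have halted: "halted A v (incident G v) (hist r G v) \<longleftrightarrow> r > T (?m G)" if "G \<in> All" "v \<in> V" for G v r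
  proof -
    have "halted A v (incident G v) (hist r G v) \<longleftrightarrow> (\<exists>s \<le> r. decide A v (incident G v) (hist s G v) \<noteq> None)"
      unfolding halted_def hist_simps(2) by (metis take_hist)
    then show ?thesis by (simp add: decide that Suc_le_eq)
  qed
  have transmitted: "transmitted A v (incident G v) (hist r G v) u = msg r G v u"
    if "G \<in> All" "v \<in> V" "u \<in> V" for G v r u
  proof -
    have "msg r (guess v (incident G v) (hist r G v)) v u = msg r G v u"
      using same(2)[of "guess v (incident G v) (hist r G v)" G v r] guess[OF that(1), of v r] that by simp
    then have "send A v (incident G v) (hist r G v) u = msg r G v u"
      by (simp add: A_def hist_simps)
    moreover have "msg r G v u = []" if "r > T (?m G)" using that by (simp add: msg_def)
    ultimately show ?thesis using that halted by (simp add: transmitted_def)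
  qed
  have history: "history A G r v = hist r G v" if "G \<in> All" "v \<in> V" for G v r
    using that(2)
  proof (induction r arbitrary: v)
    case (Suc r)
    have "verts G = V" using that(1) by (simp add: All_def)
    then show ?case using Suc transmitted that(1) by (auto simp: hist_simps fun_eq_iff)
  qed (simp add: hist_simps)
  have node_out: "node_output A G v = out v G" if "G \<in> All" "v \<in> V" for G v
  proof -
    have "(LEAST r. decide A v (incident G v) (history A G r v) \<noteq> None) = Suc (T (?m G))"
      by (rule Least_equality) (auto simp: history decide that simp del: history.simps split: if_splits)
    then show ?thesis by (simp add: node_output_def history decide that del: history.simps)
  qed
  have bits: "length (msg r G u v) \<le> b" if "G \<in> All" "u \<in> V" "v \<in> V" for r G u v
    using F(2)[of "r - 1" "?m G" u v G] enc(2) that All by (auto simp: msg_def)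
  show ?thesis
  proof (intro exI[of _ A] allI ballI conjI)
    fix m G assume G: "G \<in> graphs_on V m"
    then have GA: "G \<in> All" and m: "?m G = m" by (auto simp: graphs_on_def All_def)
    show "length (transmitted A u (incident G u) (history A G r u) v) \<le> b" if "u \<in> V" "v \<in> V" for r u v
      using GA that by (simp add: history transmitted bits del: history.simps)
    show "halted A v (incident G v) (history A G (Suc (T m)) v)" if "v \<in> V" for v
      using GA that m by (simp add: history halted del: history.simps)
    show "node_output A G v = out v G" if "v \<in> V" for v
      using GA that by (rule node_out)
  qed
qed

subsection \<open>Balanced vertex partitions\<close>

definition adj :: "ugraph \<Rightarrow> nat \<Rightarrow> nat set" where
  "adj G v = {u. {v, u} \<in> edges G}"

lemma adj_sym: "u \<in> adj G v \<longleftrightarrow> v \<in> adj G u"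
  by (simp add: adj_def insert_commute)

lemma adj_incident: "adj G v = {u. {v, u} \<in> incident G v}"
  by (auto simp: adj_def incident_def)

lemma adj_subset: "G \<in> graphs_on V m \<Longrightarrow> adj G v \<subseteq> V"
  by (auto simp: adj_def graphs_on_def simple_graph_def)

lemma card_adj:
  assumes "G \<in> graphs_on V m"
  shows "card (adj G v) = card (incident G v)"
proof -
  have e: "\<And>e. e \<in> edges G \<Longrightarrow> card e = 2" using assms by (auto simp: graphs_on_def simple_graph_def)
  have "incident G v = (\<lambda>u. {v, u}) ` adj G v"
  proof (intro equalityI subsetI)
    fix x assume "x \<in> incident G v"
    then have x: "x \<in> edges G" "v \<in> x" by (auto simp: incident_def)
    then obtain a b where "x = {a, b}" "a \<noteq> b" using e by (meson card_2_iff)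
    then obtain u where "x = {v, u}" using x(2) by blast
    then show "x \<in> (\<lambda>u. {v, u}) ` adj G v" using x(1) by (auto simp: adj_def)
  qed (auto simp: adj_def incident_def)
  moreover have "inj_on (\<lambda>u. {v, u}) (adj G v)" by (auto simp: inj_on_def doubleton_eq_iff)
  ultimately show ?thesis by (simp add: card_image)
qed

text \<open>\<open>N\<close> is the number of parts of each partition and \<open>M\<close> stands for the padded number of edges.
  The vertices of \<open>H\<close> are the numbers below \<open>p\<close>, and \<open>nb j\<close> are the neighbours of \<open>j\<close> below \<open>j\<close>.
  \<open>tup v\<close> is the tuple of the processor \<open>v\<close> (not injective: the surplus processors
  repeat tuples, which is harmless because only loads between pairs of processors matter), \<open>cellnode (a, c)\<close> relays the entry \<open>(a, c)\<close> of the demand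
  matrix of each team, \<open>ix\<close> numbers the processors, and the first \<open>2 ^ r\<close> of them relay edges.\<close>

locale listing = clique_network V "graphs_on V m" b "local_degrees_eq V"
  for V :: "nat set" and m b :: nat +
  fixes n N M p r :: nat and nb :: "nat \<Rightarrow> nat set"
    and tup :: "nat \<Rightarrow> nat \<Rightarrow> nat" and cellnode :: "nat \<times> nat \<Rightarrow> nat" and ix :: "nat \<Rightarrow> nat"
  assumes finite_V: "finite V" and card_V: "card V = n"
    and N_pos: "N > 0" and n_pos: "n > 0" and N_le: "N \<le> n" and p_le: "p \<le> n"
    and M_ge: "m \<le> M" "n * N \<le> M"
    and nb: "nb j \<subseteq> {..<j}"
    and tup: "v \<in> V \<Longrightarrow> tup v \<in> {..<p} \<rightarrow>\<^sub>E {..<N}"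
    and tup_surj: "t \<in> {..<p} \<rightarrow>\<^sub>E {..<N} \<Longrightarrow> \<exists>v \<in> V. tup v = t"
    and cellnode: "inj_on cellnode ({..<N} \<times> {..<N})" "cellnode ` ({..<N} \<times> {..<N}) \<subseteq> V"
    and ix: "bij_betw ix V {..<n}"
    and bits: "2 * n ^ 2 + 1 \<le> 2 ^ b"
    and r: "2 ^ r \<le> n" "n \<le> 2 * 2 ^ r"
begin

abbreviation "Gs \<equiv> graphs_on V m"
abbreviation "tuples \<equiv> {..<p} \<rightarrow>\<^sub>E {..<N}"
abbreviation "deg G v \<equiv> card (adj G v)"
abbreviation "d j \<equiv> card (nb j)"

text \<open>A processor needs about \<open>d j * M / N ^ 2\<close> edges at level \<open>j\<close>;
  spread over its \<open>n\<close> links this is the ideal traffic per pair of processors.\<close>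

definition lam :: "nat \<Rightarrow> real" where
  "lam j = d j * M / (n * N ^ 2)"

definition load :: "ugraph \<Rightarrow> nat \<Rightarrow> (nat \<Rightarrow> nat set) \<Rightarrow> nat \<Rightarrow> nat" where
  "load G j P v = (\<Sum>i \<in> nb j. card (adj G v \<inter> P i))"

text \<open>Controls the degree sum and the size of a part simultaneously. Over all of
  \<open>V\<close> it sums to at most 3, because \<open>m \<le> M\<close>.\<close>

definition base :: "ugraph \<Rightarrow> nat \<Rightarrow> real" where
  "base G v = deg G v / M + 1 / n"

text \<open>The factor 4 makes the balance of the base weight self-reproducing: if \<open>base\<close> sums up to at most
  \<open>10 / N\<close> on the earlier parts, then so does even \<open>weight\<close> on the new one.\<close>

definition weight :: "ugraph \<Rightarrow> nat \<Rightarrow> (nat \<Rightarrow> nat set) \<Rightarrow> nat \<Rightarrow> real" where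
  "weight G j P v = base G v + N * load G j P v / (4 * d j * M)"

text \<open>The state after \<open>j\<close> levels, empty from level \<open>j\<close> on. Carrying
  the earlier sets as a function makes a recursion over all previous levels primitive.\<close>

primrec parts :: "ugraph \<Rightarrow> (nat \<Rightarrow> nat) \<Rightarrow> nat \<Rightarrow> nat \<Rightarrow> nat set" where
  "parts G t 0 = (\<lambda>_. {})"
| "parts G t (Suc j) = (parts G t j)(j := seg V (weight G j (parts G t j)) N (t j))"

definition S :: "ugraph \<Rightarrow> (nat \<Rightarrow> nat) \<Rightarrow> nat \<Rightarrow> nat set" where
  "S G t j = parts G t (Suc j) j"

lemma parts_eq: "i < j \<Longrightarrow> parts G t j i = S G t i"
  by (induction j) (auto simp: S_def less_Suc_eq)

lemma load_cong: "(\<And>i. i < j \<Longrightarrow> P i = Q i) \<Longrightarrow> load G j P v = load G j Q v"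
  unfolding load_def using nb[of j] by (intro sum.cong) auto

text \<open>Eliminates \<open>parts\<close>: the weight at level \<open>j\<close> reads only levels
  in \<open>nb j\<close>, all of which are below \<open>j\<close>.\<close>

lemma S_eq: "S G t j = seg V (weight G j (S G t)) N (t j)"
proof -
  have "load G j (parts G t j) v = load G j (S G t) v" for v
    by (rule load_cong) (rule parts_eq)
  then show ?thesis by (simp add: S_def[of G t j] weight_def[abs_def])
qed

lemma parts_upd: "j \<le> i \<Longrightarrow> parts G (t(i := a)) j = parts G t j"
  by (induction j) auto

lemma S_upd: "i < j \<Longrightarrow> S G (t(j := a)) i = S G t i"
  by (simp add: S_def parts_upd)

text \<open>The cut at level \<open>j\<close> depends only on the earlier coordinates, so changing
  \<open>t j\<close> selects another segment of the same cut.\<close>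

lemma S_upd_same: "S G (t(j := a)) j = seg V (weight G j (S G t)) N a"
proof -
  have "load G j (S G (t(j := a))) v = load G j (S G t) v" for v
    by (rule load_cong) (rule S_upd)
  then show ?thesis by (simp add: S_eq[of G "t(j := a)"] weight_def[abs_def])
qed

lemma S_subset: "S G t j \<subseteq> V"
  by (simp add: S_eq[of G t j] seg_subset)

lemma finite_S: "finite (S G t j)"
  using S_subset finite_V by (rule finite_subset)

lemma finite_nb: "finite (nb j)"
  using nb by (rule finite_subset) simp

lemma d_le: "d j \<le> j"
  using card_mono[OF _ nb[of j]] by simp

lemma M_pos: "M > 0"
  using M_ge(2) N_pos n_pos by (metis gr0I le_zero_eq mult_eq_0_iff neq0_conv)

lemma base_pos: "base G v > 0"
  using n_pos by (simp add: base_def add_nonneg_pos)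

lemma weight_ge: "base G v \<le> weight G j P v"
  by (simp add: weight_def)

lemma weight_pos: "weight G j P v > 0"
  using base_pos weight_ge by (rule less_le_trans)

lemma interval_S: "interval_in V (S G t j)"
  unfolding S_eq[of G t j] using finite_V weight_pos by (intro interval_in_seg) (auto intro: less_imp_le)

lemma finite_adj: "G \<in> Gs \<Longrightarrow> finite (adj G v)"
  using adj_subset finite_V by (rule finite_subset)

lemma deg_le: "G \<in> Gs \<Longrightarrow> deg G v \<le> n"
  using card_mono[OF finite_V adj_subset] card_V by blast

lemma sum_deg: "G \<in> Gs \<Longrightarrow> (\<Sum>v \<in> V. deg G v) = 2 * m"
  by (simp add: card_adj sum_degrees graphs_on_def)

lemma sum_card_adj_Int:
  assumes "G \<in> Gs" "A \<subseteq> V"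
  shows "(\<Sum>v \<in> V. card (adj G v \<inter> A)) = (\<Sum>u \<in> A. deg G u)"
proof -
  have fA: "finite A" using assms(2) finite_V by (rule finite_subset)
  have "(\<Sum>v \<in> V. card (adj G v \<inter> A)) = (\<Sum>v \<in> V. \<Sum>u \<in> A. of_bool (u \<in> adj G v))"
    using fA by (simp add: of_bool_def sum.If_cases Int_commute)
  also have "\<dots> = (\<Sum>u \<in> A. \<Sum>v \<in> V. of_bool (u \<in> adj G v))" by (rule sum.swap)
  also have "\<dots> = (\<Sum>u \<in> A. deg G u)"
  proof (rule sum.cong[OF refl])
    fix u
    have "V \<inter> {v. u \<in> adj G v} = adj G u" using adj_subset[OF assms(1)] adj_sym[of _ G u] by auto
    then show "(\<Sum>v \<in> V. of_bool (u \<in> adj G v)) = deg G u"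
      using finite_V by (simp add: of_bool_def sum.If_cases)
  qed
  finally show ?thesis .
qed

lemma n_div_M: "real n / M \<le> 1 / N"
proof -
  have "real n * N \<le> M" using M_ge(2) by (metis of_nat_le_iff of_nat_mult)
  then show ?thesis using M_pos N_pos by (simp add: field_simps)
qed

lemma base_sum_bounds:
  assumes "G \<in> Gs" "(\<Sum>v \<in> A. base G v) \<le> 10 / N"
  shows "real (\<Sum>v \<in> A. deg G v) \<le> 10 * M / N" "real (card A) \<le> 10 * n / N"
proof -
  have e: "(\<Sum>v \<in> A. base G v) = real (\<Sum>v \<in> A. deg G v) / M + real (card A) / n"
    by (simp add: base_def sum.distrib sum_divide_distrib)
  have "real (\<Sum>v \<in> A. deg G v) / M \<ge> 0" "real (card A) / n \<ge> 0" by (simp_all del: of_nat_sum)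
  then have "real (\<Sum>v \<in> A. deg G v) / M \<le> 10 / N" "real (card A) / n \<le> 10 / N"
    using e assms(2) by linarith+
  then show "real (\<Sum>v \<in> A. deg G v) \<le> 10 * M / N" "real (card A) \<le> 10 * n / N"
    using M_pos N_pos n_pos by (simp_all add: field_simps)
qed

text \<open>By induction the earlier parts have degree sum at most \<open>10 * M / N\<close> and
  size at most \<open>10 * n / N\<close>. Hence the total weight is at most \<open>3 + 5/2\<close>,
  a single weight is at most \<open>(2 + 5/2) / N\<close>, and \<open>sum_seg_le\<close> returns
  \<open>10 / N\<close>. Undoing the scaling by \<open>4 * d j * M / N\<close> gives the constant
  40.\<close>

lemma S_balanced:
  assumes G: "G \<in> Gs"
  shows "(\<Sum>v \<in> S G t j. base G v) \<le> 10 / N"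
    and "real (\<Sum>v \<in> S G t j. load G j (S G t) v) \<le> 40 * d j * M / N ^ 2"
proof (induction j rule: less_induct)
  case (less j)
  let ?D = "4 * real (d j) * M" and ?W = "weight G j (S G t)" and ?load = "\<lambda>v. real (load G j (S G t) v)"
  have inn: "i < j" if "i \<in> nb j" for i using that nb[of j] by auto
  have prev: "real (\<Sum>v \<in> S G t i. deg G v) \<le> 10 * M / N" "real (card (S G t i)) \<le> 10 * n / N"
    if "i \<in> nb j" for i
    using base_sum_bounds[OF G less(1)] inn[OF that] by auto
  have load_total: "(\<Sum>v \<in> V. ?load v) \<le> d j * (10 * M / N)"
  proof -
    have "(\<Sum>v \<in> V. ?load v) = (\<Sum>i \<in> nb j. real (\<Sum>v \<in> V. card (adj G v \<inter> S G t i)))"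
      by (simp add: load_def) (rule sum.swap)
    also have "\<dots> = (\<Sum>i \<in> nb j. real (\<Sum>v \<in> S G t i. deg G v))"
      by (simp only: sum_card_adj_Int[OF G S_subset])
    also have "\<dots> \<le> (\<Sum>i \<in> nb j. 10 * M / N)" by (intro sum_mono prev)
    finally show ?thesis by simp
  qed
  have load_max: "?load v \<le> d j * (10 * n / N)" for v
  proof -
    have "?load v \<le> (\<Sum>i \<in> nb j. real (card (S G t i)))"
      unfolding load_def of_nat_sum using finite_S by (intro sum_mono of_nat_mono card_mono) auto
    also have "\<dots> \<le> (\<Sum>i \<in> nb j. 10 * n / N)" by (intro sum_mono prev)
    finally show ?thesis by simp
  qed
  \<comment> \<open>For \<open>d j = 0\<close> the quotient is a division by zero, hence 0, and the
    bound still holds.\<close>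
  have scale: "N * x / ?D \<le> y" if "x \<le> d j * (10 * z / N)" "10 * z / (4 * M) \<le> y" "0 \<le> y" for x y z :: real
  proof (cases "d j = 0")
    case False
    then have "N * x / ?D \<le> N * (d j * (10 * z / N)) / ?D"
      using that(1) by (intro divide_right_mono mult_left_mono) auto
    also have "\<dots> = 10 * z / (4 * M)" using False N_pos by (simp add: field_simps)
    finally show ?thesis using that(2) by linarith
  qed (use that in simp)
  have W_total: "sum ?W V \<le> 11/2"
  proof -
    have "(\<Sum>v \<in> V. base G v) = 2 * real m / M + 1"
      using n_pos card_V sum_deg[OF G]
      by (simp add: base_def sum.distrib flip: sum_divide_distrib of_nat_sum)
    also have "\<dots> \<le> 3" using M_ge(1) M_pos by (simp add: field_simps)
    finally have "(\<Sum>v \<in> V. base G v) \<le> 3" .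
    moreover have "N * (\<Sum>v \<in> V. ?load v) / ?D \<le> 5/2"
      using scale[of "\<Sum>v \<in> V. ?load v" "real M" "5/2"] load_total M_pos by simp
    moreover have "sum ?W V = (\<Sum>v \<in> V. base G v) + N * (\<Sum>v \<in> V. ?load v) / ?D"
      by (simp add: weight_def sum.distrib sum_distrib_left sum_divide_distrib)
    ultimately show ?thesis by linarith
  qed
  have W_max: "?W v \<le> 9/2 / N" for v
  proof -
    have "real (deg G v) / M \<le> real n / M" using deg_le[OF G] by (intro divide_right_mono) auto
    moreover have "1 / real n \<le> 1 / N" using N_le N_pos by (simp add: field_simps)
    ultimately have "base G v \<le> 2 / N" using n_div_M by (simp add: base_def)
    moreover have "N * ?load v / ?D \<le> 5/2 / N"
    proof -
      have "10 * real n / (4 * M) = 5/2 * (n / M)" by simp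
      also have "\<dots> \<le> 5/2 * (1 / N)" using n_div_M by (intro mult_left_mono) auto
      finally have "10 * real n / (4 * M) \<le> 5/2 / N" by simp
      then show ?thesis using scale[of "?load v" "real n" "5/2 / N"] load_max[of v] by simp
    qed
    ultimately show ?thesis by (simp add: weight_def)
  qed
  have "sum ?W (S G t j) \<le> sum ?W V / N + 9/2 / N"
    unfolding S_eq[of G t j] using finite_V weight_pos W_max N_pos by (intro sum_seg_le) auto
  also have "\<dots> \<le> 11/2 / N + 9/2 / N" using W_total by (intro add_right_mono divide_right_mono) auto
  finally have W: "sum ?W (S G t j) \<le> 10 / N" by simp
  show "(\<Sum>v \<in> S G t j. base G v) \<le> 10 / N"
    using W weight_ge by (meson order_trans sum_mono)
  show "real (\<Sum>v \<in> S G t j. load G j (S G t) v) \<le> 40 * d j * M / N ^ 2"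
  proof (cases "d j = 0")
    case True
    then have "nb j = {}" using finite_nb by simp
    then show ?thesis by (simp add: load_def)
  next
    case False
    have "N * (\<Sum>v \<in> S G t j. ?load v) / ?D = (\<Sum>v \<in> S G t j. N * ?load v / ?D)"
      by (simp add: sum_distrib_left sum_divide_distrib)
    also have "\<dots> \<le> sum ?W (S G t j)"
      using base_pos by (intro sum_mono) (auto simp: weight_def intro: less_imp_le)
    finally have "N * (\<Sum>v \<in> S G t j. ?load v) / ?D \<le> 10 / N" using W by linarith
    then show ?thesis using False M_pos N_pos by (simp add: field_simps power2_eq_square)
  qed
qed

lemma S_degrees: "G \<in> Gs \<Longrightarrow> real (\<Sum>v \<in> S G t j. deg G v) \<le> 10 * M / N"
  using base_sum_bounds(1) S_balanced(1) by blast

subsection \<open>Routing loads\<close>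

text \<open>The position in the lexicographic order. A node can compute it for its own edges once
  all degrees are known.\<close>

definition rank :: "ugraph \<Rightarrow> nat \<times> nat \<Rightarrow> nat" where
  "rank G e = (\<Sum>v \<in> {v \<in> V. v < fst e}. deg G v) + card {u \<in> adj G (fst e). u < snd e}"

text \<open>Each edge appears in both orientations, so it can be found from whichever end point lies
  in the earlier part.\<close>

definition darts :: "ugraph \<Rightarrow> nat set \<Rightarrow> (nat \<times> nat) set" where
  "darts G A = {e. fst e \<in> A \<and> snd e \<in> adj G (fst e)}"

lemma darts_subset: "G \<in> Gs \<Longrightarrow> darts G V \<subseteq> V \<times> V"
  using adj_subset[of G V m] by (auto simp: darts_def mem_Times_iff) blast

lemma rank_less:
  assumes "G \<in> Gs" "e \<in> darts G V"
  shows "rank G e < (\<Sum>v \<in> {v \<in> V. v < fst e}. deg G v) + deg G (fst e)"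
proof -
  have "{u \<in> adj G (fst e). u < snd e} \<subset> adj G (fst e)" using assms(2) by (auto simp: darts_def)
  then show ?thesis using psubset_card_mono[OF finite_adj[OF assms(1)]] by (simp add: rank_def)
qed

lemma sum_deg_before_mono:
  assumes "v \<in> V" "v < w"
  shows "(\<Sum>x \<in> {x \<in> V. x < v}. deg G x) + deg G v \<le> (\<Sum>x \<in> {x \<in> V. x < w}. deg G x)"
proof -
  have "(\<Sum>x \<in> {x \<in> V. x < v}. deg G x) + deg G v = (\<Sum>x \<in> insert v {x \<in> V. x < v}. deg G x)"
    using finite_V by (subst sum.insert) auto
  also have "\<dots> \<le> (\<Sum>x \<in> {x \<in> V. x < w}. deg G x)"
    using finite_V assms by (intro sum_mono2) auto
  finally show ?thesis .
qed

lemma inj_on_rank: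
  assumes G: "G \<in> Gs"
  shows "inj_on (rank G) (darts G V)"
proof -
  have lt: "rank G e \<noteq> rank G e'" if e: "e \<in> darts G V" "e' \<in> darts G V"
    and "fst e < fst e' \<or> fst e = fst e' \<and> snd e < snd e'" for e e'
    using that(3)
  proof
    assume "fst e < fst e'"
    then show ?thesis
      using sum_deg_before_mono[of "fst e" "fst e'" G] rank_less[OF G e(1)] e(1)
      by (simp add: darts_def rank_def)
  next
    assume a: "fst e = fst e' \<and> snd e < snd e'"
    then have "{u \<in> adj G (fst e). u < snd e} \<subset> {u \<in> adj G (fst e'). u < snd e'}"
      using e by (auto simp: darts_def)
    then have "card {u \<in> adj G (fst e). u < snd e} < card {u \<in> adj G (fst e'). u < snd e'}"
      using finite_adj[OF G] by (intro psubset_card_mono) auto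
    then show ?thesis using a by (simp add: rank_def)
  qed
  show ?thesis
  proof (rule inj_onI, rule ccontr)
    fix e e' assume e: "e \<in> darts G V" "e' \<in> darts G V" "rank G e = rank G e'" "e \<noteq> e'"
    then have "fst e < fst e' \<or> fst e = fst e' \<and> snd e < snd e' \<or>
        fst e' < fst e \<or> fst e' = fst e \<and> snd e' < snd e"
      by (auto simp: prod_eq_iff)
    then show False using lt[OF e(1,2)] lt[OF e(2,1)] e(3) by auto
  qed
qed

text \<open>The darts leaving an interval have consecutive ranks, so they are spread evenly over the residues.\<close>

lemma card_darts_residue:
  assumes G: "G \<in> Gs" and A: "interval_in V A"
  shows "card {e \<in> darts G A. rank G e mod n = c} \<le> ((\<Sum>v \<in> A. deg G v) - 1) div n + 1"
proof (cases "A = {}")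
  case False
  let ?a = "\<Sum>v \<in> {v \<in> V. v < Min A}. deg G v" and ?l = "\<Sum>v \<in> A. deg G v"
  have AV: "A \<subseteq> V" using A by (simp add: interval_in_def)
  then have fA: "finite A" using finite_V finite_subset by blast
  have window: "rank G e \<in> {?a..<?a + ?l}" if e: "e \<in> darts G A" for e
  proof -
    let ?v = "fst e"
    have v: "?v \<in> A" "?v \<in> V" "e \<in> darts G V" using e AV by (auto simp: darts_def)
    have min: "Min A \<in> A" "Min A \<le> ?v" using fA v False by auto
    have "?a \<le> (\<Sum>v \<in> {v \<in> V. v < ?v}. deg G v)"
      using finite_V min by (intro sum_mono2) auto
    then have "?a \<le> rank G e" by (simp add: rank_def)
    moreover have "(\<Sum>v \<in> {v \<in> V. v < ?v}. deg G v) + deg G ?v = (\<Sum>v \<in> insert ?v {v \<in> V. v < ?v}. deg G v)"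
      using finite_V by (subst sum.insert) auto
    moreover have "(\<Sum>v \<in> insert ?v {v \<in> V. v < ?v}. deg G v) \<le> (\<Sum>v \<in> {v \<in> V. v < Min A} \<union> A. deg G v)"
    proof (rule sum_mono2)
      show "insert ?v {v \<in> V. v < ?v} \<subseteq> {v \<in> V. v < Min A} \<union> A"
      proof
        fix x assume "x \<in> insert ?v {v \<in> V. v < ?v}"
        then have "x \<in> V" "x \<le> ?v" using v by auto
        then have "x \<in> A" if "Min A \<le> x" using A min(1) v(1) that unfolding interval_in_def by blast
        then show "x \<in> {v \<in> V. v < Min A} \<union> A" using \<open>x \<in> V\<close> by (cases "Min A \<le> x") auto
      qed
    qed (use finite_V fA in auto)
    moreover have "(\<Sum>v \<in> {v \<in> V. v < Min A} \<union> A. deg G v) = ?a + ?l"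
      using finite_V fA by (intro sum.union_disjoint) (auto dest: Min_le[OF fA])
    ultimately show ?thesis using rank_less[OF G v(3)] by simp
  qed
  have "inj_on (rank G) {e \<in> darts G A. rank G e mod n = c}"
    using inj_on_rank[OF G] AV by (rule_tac inj_on_subset) (auto simp: darts_def)
  moreover have "rank G ` {e \<in> darts G A. rank G e mod n = c} \<subseteq> {x \<in> {?a..<?a + ?l}. x mod n = c}"
    using window by auto
  ultimately have "card {e \<in> darts G A. rank G e mod n = c} \<le> card {x \<in> {?a..<?a + ?l}. x mod n = c}"
    by (rule card_inj_on_le) simp
  also have "\<dots> \<le> (?l - 1) div n + 1" by (rule card_residue_window[OF n_pos])
  finally show ?thesis .
qed (simp add: darts_def)

text \<open>\<open>hold G y\<close> is dealt to \<open>y\<close> in the first round. In level \<open>j\<close>, \<open>y\<close> sends its \<open>piece\<close> of the slab to each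
  member of a team, which then has \<open>got\<close> its fair share, sorts it into one \<open>cell\<close> per member of the team, and
  sends \<open>dispatch\<close> to the relay \<open>z\<close>, which passes on \<open>deliver\<close>.\<close>

definition hold :: "ugraph \<Rightarrow> nat \<Rightarrow> (nat \<times> nat) set" where
  "hold G y = {e \<in> darts G V. rank G e mod n = ix y}"

definition slab :: "ugraph \<Rightarrow> (nat \<Rightarrow> nat) \<Rightarrow> nat \<Rightarrow> (nat \<times> nat) set" where
  "slab G t j = {e \<in> darts G V. \<exists>i \<in> nb j. fst e \<in> S G t i}"

definition share :: "ugraph \<Rightarrow> nat \<Rightarrow> (nat \<Rightarrow> nat) \<Rightarrow> nat \<Rightarrow> (nat \<times> nat) set" where
  "share G y t j = {e \<in> hold G y. \<exists>i \<in> nb j. fst e \<in> S G t i}"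

definition piece :: "ugraph \<Rightarrow> nat \<Rightarrow> (nat \<Rightarrow> nat) \<Rightarrow> nat \<Rightarrow> (nat \<times> nat) set" where
  "piece G y t j = {e \<in> share G y t j. enumeration (share G y t j) e mod N = t j}"

definition got :: "ugraph \<Rightarrow> (nat \<Rightarrow> nat) \<Rightarrow> nat \<Rightarrow> (nat \<times> nat) set" where
  "got G t j = (\<Union>y \<in> V. piece G y t j)"

definition cell :: "ugraph \<Rightarrow> (nat \<Rightarrow> nat) \<Rightarrow> nat \<Rightarrow> nat \<Rightarrow> (nat \<times> nat) set" where
  "cell G t j c = {e \<in> got G t j. snd e \<in> S G (t(j := c)) j}"

text \<open>Overwriting \<open>t j\<close> makes the matrix common to the whole team. The default 0
  makes matrices equal as functions once their \<open>N * N\<close> entries agree.\<close>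

definition mat :: "ugraph \<Rightarrow> (nat \<Rightarrow> nat) \<Rightarrow> nat \<Rightarrow> nat \<Rightarrow> nat \<Rightarrow> nat" where
  "mat G t j a c = (if a < N \<and> c < N then card (cell G (t(j := a)) j c) else 0)"

definition triples :: "(nat \<Rightarrow> nat \<Rightarrow> nat) \<Rightarrow> (nat \<times> nat \<times> nat) set" where
  "triples C = {(a, c, q). a < N \<and> c < N \<and> q < C a c}"

definition is_relay_coloring :: "(nat \<Rightarrow> nat \<Rightarrow> nat) \<Rightarrow> (nat \<times> nat \<times> nat \<Rightarrow> nat) \<Rightarrow> bool" where
  "is_relay_coloring C col \<longleftrightarrow> (\<forall>x \<in> triples C. col x < 2 ^ r) \<and>
    (\<forall>a z. real (card {x \<in> triples C. fst x = a \<and> col x = z}) \<le> card {x \<in> triples C. fst x = a} / 2 ^ r + 1) \<and>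
    (\<forall>c z. real (card {x \<in> triples C. fst (snd x) = c \<and> col x = z}) \<le>
       card {x \<in> triples C. fst (snd x) = c} / 2 ^ r + 1)"

text \<open>A choice that depends on the matrix alone, so all members of a team use the same
  colouring.\<close>

definition relay :: "(nat \<Rightarrow> nat \<Rightarrow> nat) \<Rightarrow> nat \<times> nat \<times> nat \<Rightarrow> nat" where
  "relay C = (SOME col. is_relay_coloring C col)"

definition dispatch :: "ugraph \<Rightarrow> (nat \<Rightarrow> nat) \<Rightarrow> nat \<Rightarrow> nat \<Rightarrow> (nat \<times> nat) set" where
  "dispatch G t j z = {e. \<exists>c < N. e \<in> cell G t j c \<and>
     relay (mat G t j) (t j, c, enumeration (cell G t j c) e) = ix z}"

definition deliver :: "ugraph \<Rightarrow> nat \<Rightarrow> (nat \<Rightarrow> nat) \<Rightarrow> nat \<Rightarrow> (nat \<times> nat) set" where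
  "deliver G z t j = {e. snd e \<in> S G t j \<and> (\<exists>a < N. e \<in> dispatch G (t(j := a)) j z)}"

definition want :: "ugraph \<Rightarrow> (nat \<Rightarrow> nat) \<Rightarrow> nat \<Rightarrow> (nat \<times> nat) set" where
  "want G t j = {e \<in> slab G t j. snd e \<in> S G t j}"

lemma finite_triples: "finite (triples C)"
proof -
  have "triples C = (\<Union>a<N. \<Union>c<N. (\<lambda>q. (a, c, q)) ` {..<C a c})" by (auto simp: triples_def)
  then show ?thesis by simp
qed

lemma card_triples_row:
  assumes "a < N"
  shows "card {x \<in> triples C. fst x = a} = (\<Sum>c<N. C a c)"
proof -
  have "{x \<in> triples C. fst x = a} = (\<lambda>(c, q). (a, c, q)) ` (SIGMA c:{..<N}. {..<C a c})"
    using assms by (auto simp: triples_def)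
  moreover have "inj_on (\<lambda>(c, q). (a, c, q)) (SIGMA c:{..<N}. {..<C a c})" by (auto simp: inj_on_def)
  ultimately show ?thesis by (simp add: card_image)
qed

lemma card_triples_col:
  assumes "c < N"
  shows "card {x \<in> triples C. fst (snd x) = c} = (\<Sum>a<N. C a c)"
proof -
  have "{x \<in> triples C. fst (snd x) = c} = (\<lambda>(a, q). (a, c, q)) ` (SIGMA a:{..<N}. {..<C a c})"
    using assms by (auto simp: triples_def)
  moreover have "inj_on (\<lambda>(a, q). (a, c, q)) (SIGMA a:{..<N}. {..<C a c})" by (auto simp: inj_on_def)
  ultimately show ?thesis by (simp add: card_image)
qed

lemma relay: "is_relay_coloring C (relay C)"
proof -
  have "\<exists>col. is_relay_coloring C col"
    unfolding is_relay_coloring_def by (rule balanced_coloring[OF finite_triples])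
  then show ?thesis unfolding relay_def by (rule someI_ex)
qed

lemma nb_less: "i \<in> nb j \<Longrightarrow> i < j"
  using nb by auto

lemma finite_darts: "G \<in> Gs \<Longrightarrow> finite (darts G V)"
  using darts_subset finite_V by (meson finite_SigmaI finite_subset)

lemma chain_subset:
  shows "hold G y \<subseteq> darts G V" "share G y t j \<subseteq> hold G y" "piece G y t j \<subseteq> share G y t j"
    "got G t j \<subseteq> slab G t j" "cell G t j c \<subseteq> got G t j" "dispatch G t j z \<subseteq> got G t j"
    "slab G t j \<subseteq> darts G V" "share G y t j \<subseteq> slab G t j" "want G t j \<subseteq> slab G t j"
  by (auto simp: hold_def share_def piece_def got_def cell_def dispatch_def slab_def want_def)

lemma finite_chain:
  assumes "G \<in> Gs"
  shows "finite (hold G y)" "finite (share G y t j)" "finite (slab G t j)" "finite (got G t j)"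
    "finite (cell G t j c)" "finite (want G t j)"
proof -
  have "A \<subseteq> darts G V \<Longrightarrow> finite A" for A
    using finite_darts[OF assms] by (rule finite_subset[rotated])
  moreover have "hold G y \<subseteq> darts G V" "share G y t j \<subseteq> darts G V" "slab G t j \<subseteq> darts G V"
    "got G t j \<subseteq> darts G V" "cell G t j c \<subseteq> darts G V" "want G t j \<subseteq> darts G V"
    by (auto simp: hold_def share_def piece_def got_def cell_def slab_def want_def)
  ultimately show "finite (hold G y)" "finite (share G y t j)" "finite (slab G t j)" "finite (got G t j)"
    "finite (cell G t j c)" "finite (want G t j)" by blast+
qed

lemma team_eq:
  shows "slab G (t(j := a)) j = slab G t j" "share G y (t(j := a)) j = share G y t j"
    "mat G (t(j := a)) j = mat G t j"
proof -
  have "(\<exists>i \<in> nb j. v \<in> S G (t(j := a)) i) \<longleftrightarrow> (\<exists>i \<in> nb j. v \<in> S G t i)" for v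
    using S_upd[of _ j G t a] nb_less by blast
  then show "slab G (t(j := a)) j = slab G t j" "share G y (t(j := a)) j = share G y t j"
    by (simp_all add: slab_def share_def)
  show "mat G (t(j := a)) j = mat G t j"
    by (simp add: mat_def fun_eq_iff)
qed

lemma hold_unique: "e \<in> hold G y \<Longrightarrow> e \<in> hold G y' \<Longrightarrow> y \<in> V \<Longrightarrow> y' \<in> V \<Longrightarrow> y = y'"
  using ix by (auto simp: hold_def bij_betw_def inj_on_def)

text \<open>A dart has a unique holder, and its number in the holder's share, modulo
  \<open>N\<close>, fixes the team member that receives it.\<close>

lemma got_unique:
  assumes "e \<in> got G (t(j := a)) j" "e \<in> got G (t(j := a')) j"
  shows "a = a'"
proof -
  obtain y where y: "y \<in> V" "e \<in> piece G y (t(j := a)) j" using assms by (auto simp: got_def)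
  obtain y' where y': "y' \<in> V" "e \<in> piece G y' (t(j := a')) j" using assms by (auto simp: got_def)
  have "y = y'" using y y' hold_unique[of e G y y'] by (auto simp: piece_def share_def)
  then show ?thesis using y y' by (simp add: piece_def team_eq)
qed

lemma S_unique: "v \<in> S G (t(j := c)) j \<Longrightarrow> v \<in> S G (t(j := c')) j \<Longrightarrow> c = c'"
  by (simp add: S_upd_same seg_disjoint)

lemma enumeration_triple:
  assumes "G \<in> Gs" "e \<in> cell G (t(j := a)) j c" "a < N" "c < N"
  shows "(a, c, enumeration (cell G (t(j := a)) j c) e) \<in> triples (mat G t j)"
  using nth_element_enumeration(1)[OF finite_chain(5)[OF assms(1)] assms(2)] assms(3,4)
  by (simp add: triples_def mat_def)


text \<open>Follows a wanted dart along its route: its holder \<open>y\<close>, the team member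
  \<open>a\<close> that collects it, the cell of \<open>t j\<close>, and the relay \<open>z\<close>
  given by its colour.\<close>

lemma want_eq_deliver:
  assumes G: "G \<in> Gs" and t: "t j < N"
  shows "want G t j = (\<Union>z \<in> V. deliver G z t j)"
proof (intro equalityI subsetI)
  fix e assume e: "e \<in> want G t j"
  then have e': "e \<in> darts G V" "snd e \<in> S G t j" "\<exists>i \<in> nb j. fst e \<in> S G t i"
    by (auto simp: want_def slab_def)
  have surj: "\<exists>y \<in> V. ix y = k" if "k < n" for k
  proof -
    have "k \<in> ix ` V" using ix that by (simp add: bij_betw_def)
    then show ?thesis by blast
  qed
  obtain y where y: "y \<in> V" "ix y = rank G e mod n"
    using surj[of "rank G e mod n"] n_pos by auto
  define a where "a = enumeration (share G y t j) e mod N"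
  have a: "a < N" using N_pos by (simp add: a_def)
  have "e \<in> share G y t j" using e' y by (simp add: share_def hold_def)
  then have "e \<in> got G (t(j := a)) j" using y by (auto simp: got_def piece_def team_eq a_def)
  then have c: "e \<in> cell G (t(j := a)) j (t j)" using e' by (simp add: cell_def)
  let ?x = "(a, t j, enumeration (cell G (t(j := a)) j (t j)) e)"
  have "?x \<in> triples (mat G t j)" using enumeration_triple[OF G c a t] .
  then have "relay (mat G t j) ?x < n"
    using relay[of "mat G t j"] r(1) by (fastforce simp: is_relay_coloring_def)
  then obtain z where z: "z \<in> V" "ix z = relay (mat G t j) ?x" using surj by blast
  have "e \<in> dispatch G (t(j := a)) j z" using c z t by (auto simp: dispatch_def team_eq)
  then show "e \<in> (\<Union>z \<in> V. deliver G z t j)" using e' a z(1) by (auto simp: deliver_def)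
next
  fix e assume "e \<in> (\<Union>z \<in> V. deliver G z t j)"
  then obtain z a where "snd e \<in> S G t j" "e \<in> dispatch G (t(j := a)) j z" by (auto simp: deliver_def)
  then show "e \<in> want G t j"
    using chain_subset(6)[of G "t(j := a)" j z] chain_subset(4)[of G "t(j := a)" j]
    by (auto simp: want_def team_eq)
qed

section \<open>Bounds on the traffic between two processors\<close>

text \<open>A part of degree sum at most \<open>10 * M / N\<close> contributes at most
  \<open>10 * M / (n * N) + 1\<close> darts to one holder. As \<open>n * N \<le> M\<close>, the
  rounding term is absorbed and 10 becomes 11.\<close>

lemma card_share:
  assumes G: "G \<in> Gs"
  shows "real (card (share G y t j)) \<le> 11 * N * lam j"
proof -
  let ?A = "\<lambda>i. {e \<in> darts G (S G t i). rank G e mod n = ix y}"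
  have fin: "finite (?A i)" for i
    using finite_darts[OF G] by (rule finite_subset[rotated]) (use S_subset in \<open>auto simp: darts_def\<close>)
  have one: "real (card (?A i)) \<le> 11 * M / (n * N)" for i
  proof -
    have "real (card (?A i)) \<le> real (((\<Sum>v \<in> S G t i. deg G v) - 1) div n) + 1"
      using card_darts_residue[OF G interval_S[of G t i], of "ix y"] by linarith
    also have "\<dots> \<le> real ((\<Sum>v \<in> S G t i. deg G v) - 1) / n + 1"
      using of_nat_div_le_of_nat by auto
    also have "\<dots> \<le> real (\<Sum>v \<in> S G t i. deg G v) / n + 1"
      by (intro add_right_mono divide_right_mono) (auto simp del: of_nat_sum)
    also have "\<dots> \<le> (10 * M / N) / n + M / (n * N)"
    proof (intro add_mono divide_right_mono S_degrees[OF G])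
      have "n * N > 0" using n_pos N_pos by simp
      then show "1 \<le> real M / real (n * N)" using M_ge(2) by (simp only: le_divide_eq of_nat_0_less_iff) (simp flip: of_nat_mult)
    qed simp
    also have "\<dots> = 11 * M / (n * N)" using n_pos N_pos by (simp add: field_simps)
    finally show ?thesis .
  qed
  have "share G y t j \<subseteq> (\<Union>i \<in> nb j. ?A i)"
    by (auto simp: share_def hold_def darts_def)
  then have "card (share G y t j) \<le> card (\<Union>i \<in> nb j. ?A i)"
    using fin finite_nb by (intro card_mono) auto
  also have "\<dots> \<le> (\<Sum>i \<in> nb j. card (?A i))" by (rule card_UN_le[OF finite_nb])
  finally have "real (card (share G y t j)) \<le> real (\<Sum>i \<in> nb j. card (?A i))"
    by (rule of_nat_mono)
  also have "\<dots> = (\<Sum>i \<in> nb j. real (card (?A i)))" by (rule of_nat_sum)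
  also have "\<dots> \<le> (\<Sum>i \<in> nb j. 11 * M / (n * N))" by (intro sum_mono one)
  also have "\<dots> = 11 * N * lam j" using N_pos by (simp add: lam_def field_simps power2_eq_square)
  finally show ?thesis .
qed

lemma card_piece:
  assumes G: "G \<in> Gs"
  shows "real (card (piece G y t j)) \<le> 11 * lam j + 1"
proof -
  have "real (card (piece G y t j)) \<le> card (share G y t j) / N + 1"
    unfolding piece_def by (rule card_enumeration_mod[OF finite_chain(2)[OF G] N_pos])
  also have "\<dots> \<le> (11 * N * lam j) / N + 1"
    by (intro add_right_mono divide_right_mono card_share[OF G]) simp
  finally show ?thesis using N_pos by simp
qed

lemma card_got:
  assumes G: "G \<in> Gs"
  shows "real (card (got G t j)) \<le> n * (11 * lam j + 1)"
proof -
  have "card (got G t j) \<le> (\<Sum>y \<in> V. card (piece G y t j))"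
    unfolding got_def by (rule card_UN_le[OF finite_V])
  then have "real (card (got G t j)) \<le> real (\<Sum>y \<in> V. card (piece G y t j))"
    by (rule of_nat_mono)
  also have "\<dots> = (\<Sum>y \<in> V. real (card (piece G y t j)))" by (rule of_nat_sum)
  also have "\<dots> \<le> (\<Sum>y \<in> V. 11 * lam j + 1)" by (intro sum_mono card_piece[OF G])
  finally show ?thesis by (simp add: card_V)
qed

text \<open>Counting by the second end point, which lies in \<open>S G t j\<close>, reduces this to
  the balanced load.\<close>

lemma card_want:
  assumes G: "G \<in> Gs"
  shows "real (card (want G t j)) \<le> 40 * n * lam j"
proof -
  have "want G t j \<subseteq> (\<Union>u \<in> S G t j. \<Union>i \<in> nb j. (\<lambda>v. (v, u)) ` (adj G u \<inter> S G t i))"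
    using adj_sym by (fastforce simp: want_def slab_def darts_def)
  then have "card (want G t j) \<le> card (\<Union>u \<in> S G t j. \<Union>i \<in> nb j. (\<lambda>v. (v, u)) ` (adj G u \<inter> S G t i))"
    using finite_S finite_nb by (intro card_mono) auto
  also have "\<dots> \<le> (\<Sum>u \<in> S G t j. card (\<Union>i \<in> nb j. (\<lambda>v. (v, u)) ` (adj G u \<inter> S G t i)))"
    by (rule card_UN_le[OF finite_S])
  also have "\<dots> \<le> (\<Sum>u \<in> S G t j. \<Sum>i \<in> nb j. card (adj G u \<inter> S G t i))"
  proof (rule sum_mono)
    fix u
    have "card (\<Union>i \<in> nb j. (\<lambda>v. (v, u)) ` (adj G u \<inter> S G t i)) \<le> (\<Sum>i \<in> nb j. card ((\<lambda>v. (v, u)) ` (adj G u \<inter> S G t i)))"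
      by (rule card_UN_le[OF finite_nb])
    also have "\<dots> \<le> (\<Sum>i \<in> nb j. card (adj G u \<inter> S G t i))"
      using finite_S by (intro sum_mono card_image_le) auto
    finally show "card (\<Union>i \<in> nb j. (\<lambda>v. (v, u)) ` (adj G u \<inter> S G t i)) \<le> (\<Sum>i \<in> nb j. card (adj G u \<inter> S G t i))" .
  qed
  also have "\<dots> = (\<Sum>u \<in> S G t j. load G j (S G t) u)" by (simp add: load_def)
  finally have "real (card (want G t j)) \<le> real (\<Sum>u \<in> S G t j. load G j (S G t) u)"
    by (rule of_nat_mono)
  also have "\<dots> \<le> 40 * d j * M / N ^ 2" by (rule S_balanced(2)[OF G])
  also have "\<dots> = 40 * n * lam j" using n_pos by (simp add: lam_def)
  finally show ?thesis .
qed

lemma row_total: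
  assumes G: "G \<in> Gs" and a: "a < N"
  shows "(\<Sum>c<N. mat G t j a c) \<le> card (got G (t(j := a)) j)"
proof -
  have "(\<Sum>c<N. mat G t j a c) = (\<Sum>c<N. card (cell G (t(j := a)) j c))"
    using a by (simp add: mat_def)
  also have "\<dots> = card (\<Union>c<N. cell G (t(j := a)) j c)"
  proof (rule card_UN_disjoint[symmetric])
    show "\<forall>c \<in> {..<N}. \<forall>c' \<in> {..<N}. c \<noteq> c' \<longrightarrow> cell G (t(j := a)) j c \<inter> cell G (t(j := a)) j c' = {}"
      using S_unique by (auto simp: cell_def)
  qed (use finite_chain(5)[OF G] in auto)
  also have "\<dots> \<le> card (got G (t(j := a)) j)"
    using chain_subset(5) by (intro card_mono finite_chain(4)[OF G]) blast
  finally show ?thesis .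
qed

text \<open>By \<open>got_unique\<close> the cells that different members have for the same receiver
  are disjoint, and all of them lie in what that receiver wants.\<close>

lemma column_total:
  assumes G: "G \<in> Gs" and t: "t j < N"
  shows "(\<Sum>a<N. mat G t j a (t j)) \<le> card (want G t j)"
proof -
  have "(\<Sum>a<N. mat G t j a (t j)) = (\<Sum>a<N. card (cell G (t(j := a)) j (t j)))"
    using t by (simp add: mat_def)
  also have "\<dots> = card (\<Union>a<N. cell G (t(j := a)) j (t j))"
  proof (rule card_UN_disjoint[symmetric])
    show "\<forall>a \<in> {..<N}. \<forall>a' \<in> {..<N}. a \<noteq> a' \<longrightarrow>
        cell G (t(j := a)) j (t j) \<inter> cell G (t(j := a')) j (t j) = {}"
      using got_unique[of _ G t j] by (auto simp: cell_def)
  qed (use finite_chain(5)[OF G] in auto)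
  also have "\<dots> \<le> card (want G t j)"
  proof (intro card_mono finite_chain(6)[OF G] UN_least)
    fix a
    show "cell G (t(j := a)) j (t j) \<subseteq> want G t j"
      using chain_subset(4)[of G "t(j := a)" j] by (auto simp: cell_def want_def team_eq)
  qed
  finally show ?thesis .
qed

lemma n_div_colors: "real n / 2 ^ r \<le> 2"
proof -
  have "real n \<le> real (2 * 2 ^ r)" using r(2) by (rule of_nat_mono)
  then show ?thesis by (simp add: field_simps)
qed

text \<open>The row sum is at most what the sender has got. The colouring divides it among
  \<open>2 ^ r \<ge> n / 2\<close> relays, which gives
  \<open>2 * (11 * lam j + 1) + 1\<close>.\<close>

lemma card_dispatch:
  assumes G: "G \<in> Gs" and t: "t j < N"
  shows "real (card (dispatch G t j z)) \<le> 22 * lam j + 3"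
proof -
  \<comment> \<open>\<open>?h\<close> recovers a dart from its triple, so there are at most as many
    darts as triples of this row and colour.\<close>
  let ?C = "mat G t j" and ?h = "\<lambda>(a, c, q). the (nth_element q (cell G t j c))"
  let ?X = "{x \<in> triples ?C. fst x = t j \<and> relay ?C x = ix z}"
  have "dispatch G t j z \<subseteq> ?h ` ?X"
  proof
    fix e assume "e \<in> dispatch G t j z"
    then obtain c where c: "c < N" "e \<in> cell G t j c"
      "relay ?C (t j, c, enumeration (cell G t j c) e) = ix z" by (auto simp: dispatch_def)
    let ?x = "(t j, c, enumeration (cell G t j c) e)"
    have "?x \<in> ?X" using enumeration_triple[OF G _ t c(1), of e t j] c by simp
    moreover have "?h ?x = e" using nth_element_enumeration(2)[OF finite_chain(5)[OF G] c(2)] by simp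
    ultimately show "e \<in> ?h ` ?X" by force
  qed
  then have "card (dispatch G t j z) \<le> card ?X"
    using finite_triples by (intro surj_card_le) auto
  then have "real (card (dispatch G t j z)) \<le> card ?X" by simp
  also have "\<dots> \<le> card {x \<in> triples ?C. fst x = t j} / 2 ^ r + 1"
    using relay[of ?C] by (simp add: is_relay_coloring_def)
  also have "\<dots> \<le> (n * (11 * lam j + 1)) / 2 ^ r + 1"
  proof (intro add_right_mono divide_right_mono)
    have "real (card {x \<in> triples ?C. fst x = t j}) \<le> card (got G t j)"
      using row_total[OF G t, of t j] by (simp add: card_triples_row[OF t] flip: of_nat_sum)
    then show "real (card {x \<in> triples ?C. fst x = t j}) \<le> n * (11 * lam j + 1)"
      using card_got[OF G, of t j] by linarith
  qed simp
  also have "\<dots> = (n / 2 ^ r) * (11 * lam j + 1) + 1" by simp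
  also have "\<dots> \<le> 2 * (11 * lam j + 1) + 1"
    by (intro add_right_mono mult_right_mono n_div_colors) (simp add: lam_def)
  finally show ?thesis by simp
qed

text \<open>The same argument for columns: the column sum is bounded by what the receiver wants, and
  the colouring balances columns too.\<close>

lemma card_deliver:
  assumes G: "G \<in> Gs" and t: "t j < N"
  shows "real (card (deliver G z t j)) \<le> 80 * lam j + 3"
proof -
  let ?C = "mat G t j" and ?h = "\<lambda>(a, c, q). the (nth_element q (cell G (t(j := a)) j c))"
  let ?X = "{x \<in> triples ?C. fst (snd x) = t j \<and> relay ?C x = ix z}"
  have "deliver G z t j \<subseteq> ?h ` ?X"
  proof
    fix e assume "e \<in> deliver G z t j"
    then obtain a where a: "a < N" "snd e \<in> S G t j" "e \<in> dispatch G (t(j := a)) j z"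
      by (auto simp: deliver_def)
    then obtain c where c: "c < N" "e \<in> cell G (t(j := a)) j c"
      "relay ?C (a, c, enumeration (cell G (t(j := a)) j c) e) = ix z" by (auto simp: dispatch_def team_eq)
    have "snd e \<in> S G (t(j := c)) j" using c(2) by (simp add: cell_def)
    then have cj: "c = t j" using S_unique[of "snd e" G t j c "t j"] a(2) by simp
    let ?x = "(a, c, enumeration (cell G (t(j := a)) j c) e)"
    have "?x \<in> ?X" using enumeration_triple[OF G c(2) a(1) c(1)] c cj by simp
    moreover have "?h ?x = e" using nth_element_enumeration(2)[OF finite_chain(5)[OF G] c(2)] by simp
    ultimately show "e \<in> ?h ` ?X" by force
  qed
  then have "card (deliver G z t j) \<le> card ?X"
    using finite_triples by (intro surj_card_le) auto
  then have "real (card (deliver G z t j)) \<le> card ?X" by simp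
  also have "\<dots> \<le> card {x \<in> triples ?C. fst (snd x) = t j} / 2 ^ r + 1"
    using relay[of ?C] by (simp add: is_relay_coloring_def)
  also have "\<dots> \<le> (40 * n * lam j) / 2 ^ r + 1"
  proof (intro add_right_mono divide_right_mono)
    have "real (card {x \<in> triples ?C. fst (snd x) = t j}) \<le> card (want G t j)"
      using column_total[where t = t and j = j, OF G t] by (simp add: card_triples_col[OF t] flip: of_nat_sum)
    then show "real (card {x \<in> triples ?C. fst (snd x) = t j}) \<le> 40 * n * lam j"
      using card_want[OF G, of t j] by linarith
  qed simp
  also have "\<dots> = (n / 2 ^ r) * (40 * lam j) + 1" by simp
  also have "\<dots> \<le> 2 * (40 * lam j) + 1"
    by (intro add_right_mono mult_right_mono n_div_colors) (simp add: lam_def)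
  finally show ?thesis by simp
qed

subsection \<open>The rounds of the protocol\<close>

text \<open>The invariant before level \<open>j\<close>. The parts are public, that is, known for
  all tuples, whereas each node knows the wanted edges of its own tuple only.\<close>

definition known :: "nat \<Rightarrow> knowledge" where
  "known j v G G' \<longleftrightarrow> incident G v = incident G' v \<and> (\<forall>u \<in> V. deg G u = deg G' u) \<and>
     hold G v = hold G' v \<and> (\<forall>t \<in> tuples. \<forall>i < j. S G t i = S G' t i) \<and>
     (\<forall>i < j. want G (tup v) i = want G' (tup v) i)"

text \<open>A common number of rounds for the three bulk transfers of a level, whose loads are at
  most \<open>11 * lam j + 1\<close>, \<open>22 * lam j + 3\<close> and
  \<open>80 * lam j + 3\<close>.\<close>

definition L :: "nat \<Rightarrow> nat" where
  "L j = nat \<lfloor>80 * lam j + 3\<rfloor>"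

lemma lam_nonneg: "lam j \<ge> 0"
  by (simp add: lam_def)

lemma card_le_L: "real k \<le> 80 * lam j + 3 \<Longrightarrow> k \<le> L j"
  unfolding L_def by (rule le_nat_floor)

lemma codes:
  "finite (V \<times> V)" "card (V \<times> V) + 1 \<le> 2 ^ b" "finite {..n ^ 2}" "card {..n ^ 2} \<le> 2 ^ b" "card V + 1 \<le> 2 ^ b"
proof -
  show "finite (V \<times> V)" "finite {..n ^ 2}" using finite_V by auto
  show "card (V \<times> V) + 1 \<le> 2 ^ b" "card {..n ^ 2} \<le> 2 ^ b"
    using bits by (auto simp: card_cartesian_product card_V power2_eq_square)
  have "n \<le> n ^ 2" by (simp add: power2_eq_square)
  then show "card V + 1 \<le> 2 ^ b" using bits by (simp add: card_V)
qed

text \<open>The darts leaving one node have consecutive ranks and number at most \<open>n\<close>,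
  so each holder gets at most one of them. The sender is the first end point, so only the second one
  is transmitted.\<close>

lemma reach_hold: "reach 1 (known 0)"
proof -
  have "reach 0 (local_degrees_eq V)" by (rule reach.start)
  then have "reach (0 + 1) (known 0)"
  proof (rule reach_send_set[where f = "\<lambda>v y G. {u \<in> adj G v. rank G (v, u) mod n = ix y}"])
    show "finite V" by (rule finite_V)
    show "card V + 1 \<le> 2 ^ b" by (rule codes)
    show "knows (local_degrees_eq V) v (\<lambda>G. {u \<in> adj G v. rank G (v, u) mod n = ix y})"
      if "v \<in> V" "y \<in> V" for v y
    proof -
      have "{u \<in> adj G v. rank G (v, u) mod n = ix y} = {u \<in> adj G' v. rank G' (v, u) mod n = ix y}"
        if G: "G \<in> Gs" "G' \<in> Gs" and eq: "local_degrees_eq V v G G'" for G G'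
      proof -
        have "adj G v = adj G' v" using eq by (simp add: adj_incident local_degrees_eq_def)
        moreover have "(\<Sum>u \<in> {u \<in> V. u < v}. deg G u) = (\<Sum>u \<in> {u \<in> V. u < v}. deg G' u)"
          using eq by (intro sum.cong) (auto simp: local_degrees_eq_def card_adj[OF G(1)] card_adj[OF G(2)])
        ultimately show ?thesis by (simp add: rank_def)
      qed
      then show ?thesis by (simp add: knows_def)
    qed
    show "{u \<in> adj G v. rank G (v, u) mod n = ix y} \<subseteq> V \<and> card {u \<in> adj G v. rank G (v, u) mod n = ix y} \<le> 1"
      if "v \<in> V" "y \<in> V" "G \<in> Gs" for v y G
    proof
      show "{u \<in> adj G v. rank G (v, u) mod n = ix y} \<subseteq> V" using adj_subset[OF that(3)] by blast
      have "{e \<in> darts G {v}. rank G e mod n = ix y} = Pair v ` {u \<in> adj G v. rank G (v, u) mod n = ix y}"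
        by (auto simp: darts_def)
      then have "card {u \<in> adj G v. rank G (v, u) mod n = ix y} = card {e \<in> darts G {v}. rank G e mod n = ix y}"
        by (simp add: card_image inj_on_def)
      also have "\<dots> \<le> ((\<Sum>v \<in> {v}. deg G v) - 1) div n + 1"
        using that by (intro card_darts_residue) (auto simp: interval_in_def)
      also have "\<dots> = 1" using deg_le[OF that(3), of v] n_pos by simp
      finally show "card {u \<in> adj G v. rank G (v, u) mod n = ix y} \<le> 1" .
    qed
    show "known 0 v G G'" if "v \<in> V" "G \<in> Gs" "G' \<in> Gs" "local_degrees_eq V v G G'"
      "\<And>u. u \<in> V \<Longrightarrow> {w \<in> adj G u. rank G (u, w) mod n = ix v} = {w \<in> adj G' u. rank G' (u, w) mod n = ix v}"
      for v G G'
    proof -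
      have "e \<in> hold G v \<longleftrightarrow> e \<in> hold G' v" for e
        using that(5)[of "fst e"] by (cases e) (auto simp: hold_def darts_def set_eq_iff)
      then show ?thesis
        using that(4) by (auto simp: known_def local_degrees_eq_def card_adj[OF that(2)] card_adj[OF that(3)])
    qed
  qed
  then show ?thesis by simp
qed

lemma tuple_upd: "t \<in> tuples \<Longrightarrow> j < p \<Longrightarrow> a < N \<Longrightarrow> t(j := a) \<in> tuples"
  by (auto simp: PiE_iff extensional_def)

lemma tuple_less: "t \<in> tuples \<Longrightarrow> j < p \<Longrightarrow> t j < N"
  by (auto simp: PiE_iff)

lemma load_le:
  assumes "G \<in> Gs" "j < p"
  shows "load G j P v \<le> n ^ 2"
proof -
  have "load G j P v \<le> (\<Sum>i \<in> nb j. n)"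
    unfolding load_def
  proof (rule sum_mono)
    fix i
    have "card (adj G v \<inter> P i) \<le> deg G v" using finite_adj[OF assms(1)] by (intro card_mono) auto
    then show "card (adj G v \<inter> P i) \<le> n" using deg_le[OF assms(1), of v] by simp
  qed
  also have "\<dots> = d j * n" by simp
  also have "\<dots> \<le> n * n" using d_le[of j] assms(2) p_le by (intro mult_right_mono) auto
  finally show ?thesis by (simp add: power2_eq_square)
qed

lemma known_cong:
  assumes "known j v G G'"
  shows "adj G v = adj G' v" "\<And>u. u \<in> V \<Longrightarrow> deg G u = deg G' u"
    "\<And>t i. t \<in> tuples \<Longrightarrow> i \<in> nb j \<Longrightarrow> S G t i = S G' t i"
  using assms nb_less by (auto simp: known_def adj_incident)

definition known_parts :: "nat \<Rightarrow> knowledge" where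
  "known_parts j v G G' \<longleftrightarrow> known j v G G' \<and> (\<forall>t \<in> tuples. S G t j = S G' t j)"

text \<open>First every node tells every processor its load with respect to that processor's tuple;
  the earlier parts are public, so it can compute it. Then each processor knows all weights of its
  cut and announces its own interval.\<close>

lemma reach_parts:
  assumes j: "j < p" and "reach t (known j)"
  shows "reach (t + 2) (known_parts j)"
proof -
  have "reach (Suc t) (\<lambda>v G G'. known j v G G' \<and> S G (tup v) j = S G' (tup v) j)"
    using assms(2) codes(3,4)
  proof (rule reach_send[where f = "\<lambda>u v G. load G j (S G (tup v)) u"])
    show "knows (known j) u (\<lambda>G. load G j (S G (tup v)) u)" if "u \<in> V" "v \<in> V" for u v
      unfolding knows_def load_def
      using known_cong(1,3) tup[OF that(2)] by (intro ballI impI sum.cong refl) metis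
    show "load G j (S G (tup v)) u \<in> {..n ^ 2}" if "G \<in> Gs" for u v G
      using load_le[OF that j] by simp
    show "known j v G G' \<and> S G (tup v) j = S G' (tup v) j"
      if "v \<in> V" "known j v G G'" "\<And>u. u \<in> V \<Longrightarrow> load G j (S G (tup v)) u = load G' j (S G' (tup v)) u" for v G G'
    proof
      have "weight G j (S G (tup v)) u = weight G' j (S G' (tup v)) u" if "u \<in> V" for u
        using \<open>known j v G G'\<close> \<open>\<And>u. u \<in> V \<Longrightarrow> load G j (S G (tup v)) u = load G' j (S G' (tup v)) u\<close> that
        by (simp add: weight_def base_def known_def)
      then show "S G (tup v) j = S G' (tup v) j"
        unfolding S_eq[of _ "tup v" j] by (rule seg_cong)
    qed (rule that)
  qed
  then have "reach (Suc (Suc t)) (known_parts j)"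
  proof (rule reach_send[where f = "\<lambda>u v G. S G (tup u) j"])
    show "finite {A. interval_in V A}" "card {A. interval_in V A} \<le> 2 ^ b"
      using card_intervals_le[OF finite_V] bits by (auto simp: card_V)
    show "known_parts j v G G'" if "known j v G G' \<and> S G (tup v) j = S G' (tup v) j"
      "\<And>u. u \<in> V \<Longrightarrow> S G (tup u) j = S G' (tup u) j" for v G G'
      unfolding known_parts_def using that tup_surj by metis
  qed (auto simp: knows_def interval_S)
  then show ?thesis by simp
qed

definition known_got :: "nat \<Rightarrow> knowledge" where
  "known_got j v G G' \<longleftrightarrow> known_parts j v G G' \<and> got G (tup v) j = got G' (tup v) j"

lemma reach_got:
  assumes j: "j < p" and "reach t (known_parts j)"
  shows "reach (t + L j) (known_got j)"
  using assms(2) codes(1,2)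
proof (rule reach_send_set[where f = "\<lambda>y v G. piece G y (tup v) j"])
  show "knows (known_parts j) y (\<lambda>G. piece G y (tup v) j)" if "y \<in> V" "v \<in> V" for y v
    unfolding knows_def
  proof (intro ballI impI)
    fix G G' assume "known_parts j y G G'"
    then have k: "known j y G G'" by (simp add: known_parts_def)
    then have "share G y (tup v) j = share G' y (tup v) j"
      using known_cong(3)[OF k tup[OF that(2)]] by (auto simp: share_def known_def)
    then show "piece G y (tup v) j = piece G' y (tup v) j" by (simp add: piece_def)
  qed
  show "piece G y (tup v) j \<subseteq> V \<times> V \<and> card (piece G y (tup v) j) \<le> L j" if "G \<in> Gs" for y v G
  proof
    show "piece G y (tup v) j \<subseteq> V \<times> V"
      using darts_subset[OF that] by (auto simp: piece_def share_def hold_def)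
    show "card (piece G y (tup v) j) \<le> L j"
      using card_piece[OF that, of y "tup v" j] lam_nonneg[of j] by (intro card_le_L) linarith
  qed
qed (simp add: known_got_def got_def)

definition known_mat :: "nat \<Rightarrow> knowledge" where
  "known_mat j v G G' \<longleftrightarrow> known_got j v G G' \<and> mat G (tup v) j = mat G' (tup v) j"

lemma card_cell_le: "G \<in> Gs \<Longrightarrow> card (cell G t j c) \<le> n ^ 2"
proof -
  assume G: "G \<in> Gs"
  have "cell G t j c \<subseteq> V \<times> V"
    using darts_subset[OF G] by (auto simp: cell_def got_def piece_def share_def hold_def)
  then have "card (cell G t j c) \<le> card (V \<times> V)" by (intro card_mono codes)
  then show ?thesis by (simp add: card_cartesian_product card_V power2_eq_square)
qed

text \<open>First the member \<open>a\<close> of each team reports the size of its cell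
  \<open>c\<close> to \<open>cellnode (a, c)\<close>; then this relay passes to every processor the
  entry of that processor's team. Injectivity of \<open>cellnode\<close> limits each pair to one
  number per round.\<close>

lemma reach_mat:
  assumes j: "j < p" and "reach t (known_got j)"
  shows "reach (t + 2) (known_mat j)"
proof -
  let ?inv = "inv_into ({..<N} \<times> {..<N}) cellnode"
  have inv: "?inv (cellnode (a, c)) = (a, c)" if "a < N" "c < N" for a c
    using cellnode(1) that by (simp add: inv_into_f_f)
  define K where "K v G G' \<longleftrightarrow> known_got j v G G' \<and>
     (\<forall>t \<in> tuples. \<forall>c < N. cellnode (t j, c) = v \<longrightarrow> card (cell G t j c) = card (cell G' t j c))" for v G G'
  have cells: "cell G (tup v) j c = cell G' (tup v) j c"
    if "known_got j v G G'" "v \<in> V" "c < N" for v G G' c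
    using that tuple_upd[OF tup[OF that(2)] j that(3)] by (simp add: cell_def known_got_def known_parts_def)
  \<comment> \<open>Outside the range of \<open>cellnode\<close> the inverse is arbitrary; the test
    sends 0 to every node that is not a relay of the sender's row.\<close>
  define f where "f u v G = (let c = snd (?inv v) in
      if c < N \<and> cellnode (tup u j, c) = v then card (cell G (tup u) j c) else 0)" for u v G
  have "reach (Suc t) K"
    using assms(2) codes(3,4)
  proof (rule reach_send[where f = f])
    show "knows (known_got j) u (f u v)" if "u \<in> V" for u v
      unfolding knows_def f_def Let_def using cells that by auto
    show "f u v G \<in> {..n ^ 2}" if "G \<in> Gs" for u v G
      using card_cell_le[OF that] by (simp add: f_def Let_def)
    show "K v G G'" if "known_got j v G G'" and eq: "\<And>u. u \<in> V \<Longrightarrow> f u v G = f u v G'" for v G G'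
      unfolding K_def
    proof (intro conjI ballI allI impI)
      fix t c assume t: "t \<in> tuples" "c < N" "cellnode (t j, c) = v"
      obtain u where u: "u \<in> V" "tup u = t" using tup_surj[OF t(1)] by blast
      have "?inv v = (t j, c)" using inv[OF tuple_less[OF t(1) j] t(2)] t(3) by simp
      then show "card (cell G t j c) = card (cell G' t j c)" using eq[OF u(1)] u t by (simp add: f_def)
    qed (rule that)
  qed
  define g where "g u v G = (if u \<in> cellnode ` ({..<N} \<times> {..<N})
      then card (cell G ((tup v)(j := fst (?inv u))) j (snd (?inv u))) else 0)" for u v G
  from \<open>reach (Suc t) K\<close> have "reach (Suc (Suc t)) (known_mat j)"
    using codes(3,4)
  proof (rule reach_send[where f = g])
    show "knows K u (g u v)" if "u \<in> V" "v \<in> V" for u v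
      unfolding knows_def
    proof (intro ballI impI)
      fix G G' assume K: "K u G G'"
      show "g u v G = g u v G'"
      proof (cases "u \<in> cellnode ` ({..<N} \<times> {..<N})")
        case True
        then obtain a c where ac: "a < N" "c < N" "u = cellnode (a, c)" by auto
        then have "card (cell G ((tup v)(j := a)) j c) = card (cell G' ((tup v)(j := a)) j c)"
          using K tuple_upd[OF tup[OF that(2)] j ac(1)] by (simp add: K_def)
        then show ?thesis using inv[OF ac(1,2)] ac by (simp add: g_def)
      qed (simp add: g_def)
    qed
    show "g u v G \<in> {..n ^ 2}" if "G \<in> Gs" for u v G
      using card_cell_le[OF that] by (simp add: g_def)
    show "known_mat j v G G'" if "K v G G'" and eq: "\<And>u. u \<in> V \<Longrightarrow> g u v G = g u v G'" for v G G'
    proof -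
      have "mat G (tup v) j a c = mat G' (tup v) j a c" for a c
      proof (cases "a < N \<and> c < N")
        case True
        then have "cellnode (a, c) \<in> V" "cellnode (a, c) \<in> cellnode ` ({..<N} \<times> {..<N})"
          using cellnode(2) by auto
        then show ?thesis using eq[of "cellnode (a, c)"] True inv by (simp add: g_def mat_def)
      qed (auto simp: mat_def)
      then show ?thesis using that(1) by (simp add: known_mat_def K_def fun_eq_iff)
    qed
  qed
  then show ?thesis by simp
qed

definition known_dispatch :: "nat \<Rightarrow> knowledge" where
  "known_dispatch j v G G' \<longleftrightarrow> known_parts j v G G' \<and> (\<forall>t \<in> tuples. dispatch G t j v = dispatch G' t j v)"

lemma dispatch_subset: "G \<in> Gs \<Longrightarrow> dispatch G t j z \<subseteq> V \<times> V"
  using chain_subset(6)[of G t j z] chain_subset(4)[of G t j] chain_subset(7)[of G t j] darts_subset[of G] by blast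

text \<open>A sender knows its own cells and the matrix, hence the colouring. The relay afterwards
  keeps only the parts and the darts entrusted to it.\<close>

lemma reach_dispatch:
  assumes j: "j < p" and "reach t (known_mat j)"
  shows "reach (t + L j) (known_dispatch j)"
  using assms(2) codes(1,2)
proof (rule reach_send_set[where f = "\<lambda>u v G. dispatch G (tup u) j v"])
  show "knows (known_mat j) u (\<lambda>G. dispatch G (tup u) j v)" if "u \<in> V" for u v
    unfolding knows_def
  proof (intro ballI impI)
    fix G G' assume k: "known_mat j u G G'"
    have "cell G (tup u) j c = cell G' (tup u) j c" if "c < N" for c
      using k tuple_upd[OF tup[OF \<open>u \<in> V\<close>] j that]
      by (simp add: cell_def known_mat_def known_got_def known_parts_def)
    then show "dispatch G (tup u) j v = dispatch G' (tup u) j v"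
      using k by (auto simp: dispatch_def known_mat_def)
  qed
  show "dispatch G (tup u) j v \<subseteq> V \<times> V \<and> card (dispatch G (tup u) j v) \<le> L j"
    if "u \<in> V" "G \<in> Gs" for u v G
    using dispatch_subset[OF that(2)] card_dispatch[where t = "tup u" and j = j and z = v, OF that(2) tuple_less[OF tup[OF that(1)] j]] lam_nonneg[of j]
    by (auto intro!: card_le_L)
  show "known_dispatch j v G G'" if "known_mat j v G G'"
    "\<And>u. u \<in> V \<Longrightarrow> dispatch G (tup u) j v = dispatch G' (tup u) j v" for v G G'
    unfolding known_dispatch_def using that tup_surj by (metis known_mat_def known_got_def)
qed

lemma reach_want:
  assumes j: "j < p" and "reach t (known_dispatch j)"
  shows "reach (t + L j) (known (Suc j))"
  using assms(2) codes(1,2)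
proof (rule reach_send_set[where f = "\<lambda>z v G. deliver G z (tup v) j"])
  show "knows (known_dispatch j) z (\<lambda>G. deliver G z (tup v) j)" if "v \<in> V" for z v
    unfolding knows_def
  proof (intro ballI impI)
    fix G G' assume k: "known_dispatch j z G G'"
    have "dispatch G ((tup v)(j := a)) j z = dispatch G' ((tup v)(j := a)) j z" if "a < N" for a
      using k tuple_upd[OF tup[OF \<open>v \<in> V\<close>] j that] by (simp add: known_dispatch_def)
    moreover have "S G (tup v) j = S G' (tup v) j"
      using k tup[OF that] by (simp add: known_dispatch_def known_parts_def)
    ultimately show "deliver G z (tup v) j = deliver G' z (tup v) j"
      by (auto simp: deliver_def)
  qed
  show "deliver G z (tup v) j \<subseteq> V \<times> V \<and> card (deliver G z (tup v) j) \<le> L j"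
    if "v \<in> V" "G \<in> Gs" for z v G
  proof
    show "deliver G z (tup v) j \<subseteq> V \<times> V" using dispatch_subset[OF that(2)] by (auto simp: deliver_def)
    show "card (deliver G z (tup v) j) \<le> L j"
      by (intro card_le_L card_deliver that tuple_less tup j)
  qed
  show "known (Suc j) v G G'" if "v \<in> V" "G \<in> Gs" "G' \<in> Gs" "known_dispatch j v G G'"
    "\<And>z. z \<in> V \<Longrightarrow> deliver G z (tup v) j = deliver G' z (tup v) j" for v G G'
  proof -
    have "want G (tup v) j = want G' (tup v) j"
      using that tuple_less[OF tup[OF that(1)] j] by (simp add: want_eq_deliver)
    then show ?thesis
      using that(4) by (auto simp: known_def known_dispatch_def known_parts_def less_Suc_eq)
  qed
qed

text \<open>A level takes two rounds for the parts, two for the matrix, and three bulk transfers;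
  the leading 1 is the dealing of edges.\<close>

lemma reach_known: "j \<le> p \<Longrightarrow> reach (1 + (\<Sum>i<j. 4 + 3 * L i)) (known j)"
proof (induction j)
  case 0
  then show ?case using reach_hold by simp
next
  case (Suc j)
  then have j: "j < p" and "reach (1 + (\<Sum>i<j. 4 + 3 * L i)) (known j)" by auto
  from reach_want[OF j reach_dispatch[OF j reach_mat[OF j reach_got[OF j reach_parts[OF this]]]]]
  show ?case by (rule back_subst[of "\<lambda>t. reach t (known (Suc j))"]) simp
qed

section \<open>Output and correctness\<close>

text \<open>Only the edges of a copy must be among the wanted ones. The vertex set \<open>V\<close>
  is known to everybody, so isolated vertices of \<open>H\<close> need no communication.\<close>

definition out :: "ugraph \<Rightarrow> nat \<Rightarrow> ugraph \<Rightarrow> ugraph set" where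
  "out H v G = {K. simple_graph K \<and> verts K \<subseteq> V \<and> isomorphic H K \<and>
     edges K \<subseteq> (\<lambda>(v, u). {v, u}) ` (\<Union>j<p. want G (tup v) j)}"

lemma knows_out: "knows (known p) v (out H v)"
proof -
  have "(\<Union>j<p. want G (tup v) j) = (\<Union>j<p. want G' (tup v) j)" if "known p v G G'" for G G'
    using that by (auto simp: known_def)
  then show ?thesis by (simp add: knows_def out_def)
qed

text \<open>The coordinates are chosen one after the other: the segments of each cut cover
  \<open>V\<close>, and setting \<open>t j\<close> leaves the earlier parts unchanged.\<close>

lemma exists_tuple:
  assumes "\<And>j. j < p \<Longrightarrow> \<phi> j \<in> V"
  shows "\<exists>t \<in> tuples. \<forall>j < p. \<phi> j \<in> S G t j"
proof -
  have "\<exists>t \<in> tuples. \<forall>i < j. \<phi> i \<in> S G t i" if "j \<le> p" for j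
    using that
  proof (induction j)
    case 0
    have "(\<lambda>i \<in> {..<p}. 0) \<in> tuples" using N_pos by auto
    then show ?case by blast
  next
    case (Suc j)
    then obtain t where t: "t \<in> tuples" "\<forall>i < j. \<phi> i \<in> S G t i" by auto
    obtain a where a: "a < N" "\<phi> j \<in> seg V (weight G j (S G t)) N a"
      using seg_cover[OF finite_V weight_pos N_pos] assms Suc.prems by (meson Suc_le_lessD)
    have "\<phi> i \<in> S G (t(j := a)) i" if "i < Suc j" for i
      using that t(2) a(2) by (cases "i = j") (auto simp: S_upd_same S_upd)
    then show ?case using tuple_upd[OF t(1) _ a(1), of j] Suc.prems by (metis Suc_le_lessD)
  qed
  then show ?thesis by blast
qed

text \<open>A copy follows some tuple. Its edge for \<open>{\<sigma> i, \<sigma> j}\<close> with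
  \<open>i < j\<close> runs from part \<open>i\<close> to part \<open>j\<close>, so it is wanted at
  level \<open>j\<close>. Conversely, wanted darts are edges of \<open>G\<close>, so no false copy
  is listed.\<close>

lemma out_covers:
  assumes G: "G \<in> Gs" and H: "simple_graph H" and \<sigma>: "bij_betw \<sigma> {..<p} (verts H)"
    and nbH: "\<And>i j. i < j \<Longrightarrow> j < p \<Longrightarrow> {\<sigma> i, \<sigma> j} \<in> edges H \<Longrightarrow> i \<in> nb j"
  shows "(\<Union>v \<in> V. out H v G) = copies H G"
proof (intro equalityI subsetI)
  fix K assume "K \<in> (\<Union>v \<in> V. out H v G)"
  then obtain v where K: "simple_graph K" "verts K \<subseteq> V" "isomorphic H K"
    "edges K \<subseteq> (\<lambda>(v, u). {v, u}) ` (\<Union>j<p. want G (tup v) j)" by (auto simp: out_def)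
  have "edges K \<subseteq> edges G"
    using K(4) by (fastforce simp: want_def slab_def darts_def adj_def)
  then show "K \<in> copies H G" using K G by (simp add: copies_def subgraph_def graphs_on_def)
next
  fix K assume "K \<in> copies H G"
  then have K: "simple_graph K" "verts K \<subseteq> V" "edges K \<subseteq> edges G" "isomorphic H K"
    using G by (auto simp: copies_def subgraph_def graphs_on_def)
  then obtain f where f: "bij_betw f (verts H) (verts K)" "edges K = (\<lambda>e. f ` e) ` edges H"
    by (auto simp: isomorphic_def)
  have "f (\<sigma> j) \<in> V" if "j < p" for j
  proof -
    have "\<sigma> j \<in> verts H" using bij_betwE[OF \<sigma>] that by simp
    then show ?thesis using bij_betwE[OF f(1)] K(2) by blast
  qed
  then obtain t where t: "t \<in> tuples" "\<And>j. j < p \<Longrightarrow> f (\<sigma> j) \<in> S G t j"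
    using exists_tuple[of "f \<circ> \<sigma>" G] by auto
  obtain v where v: "v \<in> V" "tup v = t" using tup_surj[OF t(1)] by blast
  have "edges K \<subseteq> (\<lambda>(v, u). {v, u}) ` (\<Union>j<p. want G t j)"
  proof
    fix e assume "e \<in> edges K"
    then obtain e' where e': "e' \<in> edges H" "e = f ` e'" using f(2) by blast
    then have "e' \<subseteq> verts H" "card e' = 2" using H by (auto simp: simple_graph_def)
    then obtain x y where xy: "e' = {x, y}" "x \<noteq> y" "x \<in> verts H" "y \<in> verts H"
      by (auto simp: card_2_iff)
    obtain i j where ij: "i < p" "j < p" "x = \<sigma> i" "y = \<sigma> j"
      using xy(3,4) unfolding bij_betw_imp_surj_on[OF \<sigma>, symmetric] by blast
    have main: "e \<in> (\<lambda>(v, u). {v, u}) ` (\<Union>j<p. want G t j)" if "i < j" "j < p" "e' = {\<sigma> i, \<sigma> j}" for i j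
    proof -
      have "i \<in> nb j" using nbH[OF that(1,2)] e'(1) that(3) by simp
      moreover have "f (\<sigma> j) \<in> adj G (f (\<sigma> i))"
        using \<open>e \<in> edges K\<close> K(3) e'(2) that(3) by (auto simp: adj_def)
      ultimately have "(f (\<sigma> i), f (\<sigma> j)) \<in> want G t j"
        using t(2)[OF that(2)] t(2)[of i] that S_subset by (auto simp: want_def slab_def darts_def)
      moreover have "e = {f (\<sigma> i), f (\<sigma> j)}" using e'(2) that(3) by simp
      ultimately show ?thesis using that(2) by force
    qed
    have "i \<noteq> j" using ij xy by auto
    then show "e \<in> (\<lambda>(v, u). {v, u}) ` (\<Union>j<p. want G t j)"
      using main[of i j] main[of j i] ij xy(1) by (metis insert_commute linorder_neqE_nat)
  qed
  then show "K \<in> (\<Union>v \<in> V. out H v G)" using K v by (auto simp: out_def)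
qed

text \<open>Each level costs at most \<open>4 + 3 * (80 * lam i + 3)\<close> rounds.\<close>

lemma rounds_le: "real (1 + (\<Sum>i<p. 4 + 3 * L i)) \<le> 1 + 13 * real p + 240 * (\<Sum>i<p. real (d i)) * M / (n * N ^ 2)"
proof -
  have "real (L i) \<le> 80 * lam i + 3" for i
    using lam_nonneg[of i] unfolding L_def by linarith
  then have "(\<Sum>i<p. 4 + 3 * real (L i)) \<le> (\<Sum>i<p. 13 + 240 * lam i)"
  proof (intro sum_mono)
    show "4 + 3 * real (L i) \<le> 13 + 240 * lam i" for i
      using \<open>real (L i) \<le> 80 * lam i + 3\<close> by linarith
  qed
  also have "\<dots> = 13 * real p + 240 * (\<Sum>i<p. lam i)"
    by (simp add: sum.distrib flip: sum_distrib_left)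
  also have "(\<Sum>i<p. lam i) = (\<Sum>i<p. real (d i)) * M / (n * N ^ 2)"
    by (simp add: lam_def flip: sum_distrib_right sum_divide_distrib)
  finally show ?thesis by simp
qed

end

subsection \<open>Choice of the parameters\<close>

lemma (in listing) listing_protocol:
  assumes "simple_graph H" "bij_betw \<sigma> {..<p} (verts H)"
    and "\<And>i j. i < j \<Longrightarrow> j < p \<Longrightarrow> {\<sigma> i, \<sigma> j} \<in> edges H \<Longrightarrow> i \<in> nb j"
  shows "\<exists>T E out. reach T E \<and> (\<forall>v \<in> V. knows E v (out v)) \<and>
    (\<forall>G \<in> Gs. (\<Union>v \<in> V. out v G) = copies H G) \<and>
    real T \<le> 1 + 13 * real p + 240 * (\<Sum>i<p. real (card (nb i))) * M / (n * N ^ 2)"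
  using reach_known[OF order_refl] knows_out out_covers[OF _ assms] rounds_le by blast

section \<open>Numerical estimates and existence of the parameters\<close>

text \<open>Every edge is counted only at the end point with the larger number.\<close>

lemma sum_back_degrees_le:
  fixes p :: nat
  assumes H: "simple_graph H" and \<sigma>: "bij_betw \<sigma> {..<p} (verts H)"
  shows "(\<Sum>j<p. card {i. i < j \<and> {\<sigma> i, \<sigma> j} \<in> edges H}) \<le> card (edges H)"
proof -
  let ?P = "SIGMA j:{..<p}. {i. i < j \<and> {\<sigma> i, \<sigma> j} \<in> edges H}"
  have inj: "\<sigma> i = \<sigma> j \<longleftrightarrow> i = j" if "i < p" "j < p" for i j
    using \<sigma> that by (auto simp: bij_betw_def inj_on_def)
  have "inj_on (\<lambda>(j, i). {\<sigma> i, \<sigma> j}) ?P"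
  proof (rule inj_onI)
    fix x y assume xy: "x \<in> ?P" "y \<in> ?P" "(\<lambda>(j, i). {\<sigma> i, \<sigma> j}) x = (\<lambda>(j, i). {\<sigma> i, \<sigma> j}) y"
    obtain j i j' i' where e: "x = (j, i)" "y = (j', i')" by fastforce
    have lt: "i < j" "j < p" "i' < j'" "j' < p" using xy(1,2) e by auto
    moreover have "i < p" by (rule less_trans[OF lt(1,2)])
    moreover have "i' < p" by (rule less_trans[OF lt(3,4)])
    ultimately have "\<sigma> i = \<sigma> i' \<longleftrightarrow> i = i'" "\<sigma> j = \<sigma> j' \<longleftrightarrow> j = j'" "\<sigma> i = \<sigma> j' \<longleftrightarrow> i = j'" "\<sigma> j = \<sigma> i' \<longleftrightarrow> j = i'"
      using inj[of i i'] inj[of j j'] inj[of i j'] inj[of j i'] by simp_all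
    then show "x = y" using xy(3) lt unfolding e prod.case doubleton_eq_iff by auto
  qed
  moreover have "(\<lambda>(j, i). {\<sigma> i, \<sigma> j}) ` ?P \<subseteq> edges H" by auto
  moreover have "finite (edges H)"
    using H by (auto simp: simple_graph_def intro: finite_subset[of "edges H" "Pow (verts H)"])
  ultimately have "card ?P \<le> card (edges H)" by (rule card_inj_on_le)
  then show ?thesis by simp
qed

text \<open>Rounding down costs at most a factor 2, and \<open>n ^ 5 / 2\<close> is at least
  \<open>4 * n ^ 2\<close> for \<open>n \<ge> 2\<close>.\<close>

lemma message_bits:
  fixes n :: nat
  assumes "n \<ge> 2"
  shows "2 * n ^ 2 + 1 \<le> 2 ^ nat \<lfloor>5 * log 2 n\<rfloor>"
proof -
  have "5 * log 2 n - 1 \<le> real (nat \<lfloor>5 * log 2 n\<rfloor>)" by linarith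
  then have "2 powr (5 * log 2 n - 1) \<le> 2 powr real (nat \<lfloor>5 * log 2 n\<rfloor>)" by simp
  also have "\<dots> = 2 ^ nat \<lfloor>5 * log 2 n\<rfloor>" by (simp add: powr_realpow)
  finally have "2 powr (5 * log 2 n - 1) \<le> 2 ^ nat \<lfloor>5 * log 2 n\<rfloor>" .
  moreover have "2 powr (5 * log 2 n - 1) = real n ^ 5 / 2"
  proof -
    have "2 powr (5 * log 2 n) = (2 powr log 2 n) powr 5" by (simp add: powr_powr mult.commute)
    also have "\<dots> = real n ^ 5" using assms powr_realpow[of "real n" 5] by simp
    finally show ?thesis by (simp add: powr_diff)
  qed
  moreover have "2 * real n ^ 2 + 1 \<le> real n ^ 5 / 2"
  proof -
    have n: "real n \<ge> 2" using assms by simp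
    have "real n ^ 5 = real n ^ 3 * real n ^ 2" by (simp flip: power_add)
    also have "\<dots> \<ge> 2 ^ 3 * real n ^ 2" using n by (intro mult_right_mono power_mono) auto
    finally have "real n ^ 5 \<ge> 8 * real n ^ 2" by simp
    moreover have "real n ^ 2 \<ge> 2 ^ 2" using n by (intro power_mono) auto
    ultimately show ?thesis by simp
  qed
  ultimately have "real (2 * n ^ 2 + 1) \<le> real (2 ^ nat \<lfloor>5 * log 2 n\<rfloor>)" by simp
  then show ?thesis by (rule of_nat_le_iff[THEN iffD1])
qed

text \<open>The bound on \<open>p\<close> gives \<open>n powr (1 / p) \<ge> 2\<close>, so the floor
  is positive and loses at most a factor 2.\<close>

lemma root_floor:
  fixes n p N :: nat
  assumes "p \<ge> 1" "real p \<le> log 2 n" "n \<ge> 2" and N_def: "N = nat \<lfloor>real n powr (1 / p)\<rfloor>"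
  shows "N ^ p \<le> n" "real n powr (1 / p) \<le> 2 * N" "real N \<le> real n powr (1 / p)" "N > 0"
proof -
  let ?x = "real n powr (1 / p)"
  have "2 powr real p \<le> n" using assms by (simp add: le_log_iff)
  then have "(2 powr real p) powr (1 / p) \<le> ?x" by (intro powr_mono2) auto
  then have x: "?x \<ge> 2" using assms(1) by (simp add: powr_powr)
  show N: "real N \<le> ?x" unfolding N_def using x by linarith
  show "?x \<le> 2 * N" "N > 0" unfolding N_def using x by linarith+
  have "real (N ^ p) \<le> ?x ^ p" using N by (simp add: power_mono)
  also have "\<dots> = ?x powr real p" by (rule powr_realpow[symmetric]) (use x in linarith)
  also have "\<dots> = n" using assms(1,3) by (simp add: powr_powr)
  finally show "N ^ p \<le> n" by simp
qed

text \<open>The factor 4 is the square of the loss from rounding the root.\<close>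

lemma round_term_le:
  fixes n p m N :: nat
  assumes "n > 0" "real n powr (1 / p) \<le> 2 * N" "real N \<le> real n powr (1 / p)"
  shows "real (max m (n * N)) / (n * N ^ 2) \<le> 4 * (padded_edges n m p / real n powr (1 + 2 / p))"
proof -
  let ?x = "real n powr (1 / p)"
  have x: "?x > 0" using assms(1) by simp
  have N: "N > 0" using x assms(2) by (cases N) auto
  have "real (n * N) \<le> real n powr (1 + 1 / p)"
    using assms(1,3) by (simp add: powr_add mult_left_mono)
  then have 1: "real (max m (n * N)) \<le> padded_edges n m p"
    unfolding padded_edges_def of_nat_max by (rule max.mono[OF order_refl])
  have "1 + 2 / real p = 1 + (1 / p + 1 / p)" by simp
  then have "real n powr (1 + 2 / p) = n * ?x ^ 2"
    using assms(1) by (simp only: powr_add) (simp add: power2_eq_square)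
  also have "\<dots> \<le> n * real (2 * N) ^ 2" using assms(2) x by (intro mult_left_mono power_mono) auto
  finally have 2: "real n powr (1 + 2 / p) \<le> 4 * (n * N ^ 2)" by (simp add: power_mult_distrib)
  have "padded_edges n m p \<ge> 0" by (simp add: padded_edges_def)
  have "real (max m (n * N)) / (n * N ^ 2) \<le> padded_edges n m p / (n * N ^ 2)"
    using 1 by (intro divide_right_mono) auto
  also have "\<dots> = 4 * (padded_edges n m p / (4 * (n * N ^ 2)))" by simp
  also have "\<dots> \<le> 4 * (padded_edges n m p / real n powr (1 + 2 / p))"
    using 2 assms(1) N \<open>padded_edges n m p \<ge> 0\<close> by (intro mult_left_mono divide_left_mono) (auto simp del: of_nat_mult of_nat_power)
  finally show ?thesis .
qed

text \<open>There are \<open>N ^ p \<le> n\<close> tuples and \<open>N * N \<le> n\<close> matrix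
  entries, so both embed into \<open>V\<close>; \<open>2 ^ r\<close> is the largest power of two up
  to \<open>n\<close>.\<close>

lemma listing_parameters:
  fixes V :: "nat set" and N p :: nat
  assumes "finite V" "card V = n" "N > 0" "N ^ p \<le> n" "N * N \<le> n"
  obtains r :: nat and tup :: "nat \<Rightarrow> nat \<Rightarrow> nat" and cellnode :: "nat \<times> nat \<Rightarrow> nat" and ix :: "nat \<Rightarrow> nat"
  where "\<And>v. v \<in> V \<Longrightarrow> tup v \<in> {..<p} \<rightarrow>\<^sub>E {..<N}"
    "\<And>t. t \<in> {..<p} \<rightarrow>\<^sub>E {..<N} \<Longrightarrow> \<exists>v \<in> V. tup v = t"
    "inj_on cellnode ({..<N} \<times> {..<N})" "cellnode ` ({..<N} \<times> {..<N}) \<subseteq> V"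
    "bij_betw ix V {..<n}" "2 ^ r \<le> n" "n \<le> 2 * 2 ^ r"
proof -
  let ?T = "{..<p} \<rightarrow>\<^sub>E {..<N}"
  have T: "finite ?T" "card ?T \<le> card V" using assms by (auto intro: finite_PiE simp: card_PiE)
  have t0: "(\<lambda>i \<in> {..<p}. 0) \<in> ?T" using assms(3) by auto
  obtain g where g: "g ` ?T \<subseteq> V" "inj_on g ?T" using card_le_inj[OF T(1) assms(1) T(2)] by blast
  define tup where "tup v = (if v \<in> g ` ?T then inv_into ?T g v else (\<lambda>i \<in> {..<p}. 0))" for v
  have 1: "tup v \<in> ?T" for v using t0 inv_into_into[of v g ?T] by (auto simp: tup_def)
  have 2: "\<exists>v \<in> V. tup v = t" if "t \<in> ?T" for t
    using g that by (intro bexI[of _ "g t"]) (auto simp: tup_def)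
  obtain cellnode where c: "cellnode ` ({..<N} \<times> {..<N}) \<subseteq> V" "inj_on cellnode ({..<N} \<times> {..<N})"
    using card_le_inj[of "{..<N} \<times> {..<N}" V] assms by (auto simp: card_cartesian_product)
  obtain ix where ix: "bij_betw ix V {..<n}"
    using ex_bij_betw_finite_nat[OF assms(1)] assms(2) by (auto simp: lessThan_atLeast0)
  have "n \<ge> 1" using assms(3,4) by (metis One_nat_def Suc_leI le_trans zero_less_power)
  then obtain r where "2 ^ r \<le> n" "n < 2 ^ (r + 1)" using ex_power_ivl1[of 2 n] by auto
  then show thesis using that[OF 1 2 c(2,1) ix, of r] by simp
qed

theorem theorem2:
  shows "\<exists>(c :: real) (C :: real). \<forall>(V :: nat set) (H :: ugraph) (n :: nat) (p :: nat) (k :: nat).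
    finite V \<and> card V = n \<and>
    simple_graph H \<and> card (verts H) = p \<and> card (edges H) = k \<and>
    1 \<le> p \<and> real p \<le> log 2 (real n) \<longrightarrow>
    (\<exists>A :: cc_algorithm. \<forall>(G :: ugraph) (m :: nat).
       simple_graph G \<and> verts G = V \<and> card (edges G) = m \<longrightarrow>
       bandwidth_at_most A G (c * log 2 (real n)) \<and>
       terminates_within A G (C * round_bound n m p k) \<and>
       lists_all_copies A H G)"
\<comment> \<open>5 is the factor of the message length in \<open>message_bits\<close>; 960 is 240
  from \<open>rounds_le\<close> times 4 from \<open>round_term_le\<close>.\<close>
proof (rule exI[of _ 5], rule exI[of _ 960], intro allI impI, elim conjE)
  fix V :: "nat set" and H :: ugraph and n p k :: nat
  assume V: "finite V" "card V = n" and H: "simple_graph H" "card (verts H) = p" "card (edges H) = k"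
    and p: "1 \<le> p" "real p \<le> log 2 (real n)"
  have n: "n \<ge> 2"
  proof (rule ccontr)
    assume "\<not> n \<ge> 2"
    then have "n = 0 \<or> n = 1" by auto
    then show False using p by (auto simp: log_def)
  qed
  have "p \<le> n"
  proof -
    have "2 powr real p \<le> n" using p n by (simp add: le_log_iff)
    then have "2 ^ p \<le> real n" by (simp add: powr_realpow)
    then show ?thesis using of_nat_less_two_power[of p, where 'a = real] by linarith
  qed
  \<comment> \<open>For \<open>p = 1\<close> the root would be \<open>n\<close>, too large for the
    \<open>N * N\<close> relays of the matrix. One part suffices, as there are no edges to
    fetch.\<close>
  define N where "N = (if p = 1 then 1 else nat \<lfloor>real n powr (1 / p)\<rfloor>)"
  note root = root_floor[OF p n refl]
  have N: "N > 0" "N ^ p \<le> n" using root n by (auto simp: N_def)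
  have NN: "N * N \<le> n"
  proof (cases "p = 1")
    case False
    then have "N ^ 2 \<le> N ^ p" using p N(1) by (intro power_increasing) auto
    then show ?thesis using N(2) by (simp add: power2_eq_square)
  qed (use n in \<open>simp add: N_def\<close>)
  have "finite (verts H)" using H by (simp add: simple_graph_def)
  then obtain \<sigma> where \<sigma>: "bij_betw \<sigma> {..<p} (verts H)"
    using ex_bij_betw_nat_finite[of "verts H"] H(2) by (auto simp: lessThan_atLeast0)
  define nb where "nb j = {i. i < j \<and> {\<sigma> i, \<sigma> j} \<in> edges H}" for j
  define b where "b = nat \<lfloor>5 * log 2 n\<rfloor>"
  obtain r tup cellnode ix where par: "\<And>v. v \<in> V \<Longrightarrow> tup v \<in> {..<p} \<rightarrow>\<^sub>E {..<N}"
    "\<And>t. t \<in> {..<p} \<rightarrow>\<^sub>E {..<N} \<Longrightarrow> \<exists>v \<in> V. tup v = t"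
    "inj_on cellnode ({..<N} \<times> {..<N})" "cellnode ` ({..<N} \<times> {..<N}) \<subseteq> V"
    "bij_betw ix V {..<n}" "2 ^ r \<le> n" "n \<le> 2 * 2 ^ r"
    by (rule listing_parameters[OF V N NN]) (rule that)
  have listing: "listing V m b n N (max m (n * N)) p r nb tup cellnode ix" for m
  proof
    show "N \<le> n" using NN N(1) by (meson le_square le_trans)
    show "2 * n\<^sup>2 + 1 \<le> 2 ^ b" unfolding b_def by (rule message_bits[OF n])
  qed (use V N n \<open>p \<le> n\<close> par in \<open>auto simp: nb_def\<close>)
  define good where "good m x \<longleftrightarrow> (case x of (T, E, out) \<Rightarrow>
    clique_network.reach V (graphs_on V m) b (local_degrees_eq V) T E \<and>
    (\<forall>v \<in> V. clique_network.knows (graphs_on V m) E v (out v)) \<and>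
    (\<forall>G \<in> graphs_on V m. (\<Union>v \<in> V. out v G) = copies H G) \<and>
    real T \<le> 1 + 13 * real p + 240 * (\<Sum>i<p. real (card (nb i))) * (max m (n * N)) / (n * N ^ 2))" for m x
  have "\<exists>x. good m x" for m
  proof -
    have "\<exists>T E out. good m (T, E, out)"
      unfolding good_def prod.case by (rule listing.listing_protocol[OF listing H(1) \<sigma>]) (simp add: nb_def)
    then show ?thesis by blast
  qed
  then obtain f where f: "\<And>m. good m (f m)" by metis
  define T where "T m = fst (f m)" for m
  define E where "E m = fst (snd (f m))" for m
  define out where "out m = snd (snd (f m))" for m
  have P: "clique_network.reach V (graphs_on V m) b (local_degrees_eq V) (T m) (E m)"
    "\<And>v. v \<in> V \<Longrightarrow> clique_network.knows (graphs_on V m) (E m) v (out m v)"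
    "\<And>G. G \<in> graphs_on V m \<Longrightarrow> (\<Union>v \<in> V. out m v G) = copies H G"
    "real (T m) \<le> 1 + 13 * real p + 240 * (\<Sum>i<p. real (card (nb i))) * (max m (n * N)) / (n * N ^ 2)" for m
    using f[of m] by (auto simp: good_def T_def E_def out_def split: prod.splits)
  have time: "real (Suc (T m)) \<le> 960 * round_bound n m p k" for m
  proof -
    let ?d = "\<Sum>i<p. real (card (nb i))"
    let ?y = "padded_edges n m p / real n powr (1 + 2 / real p)"
    have "?d * (real (max m (n * N)) / (n * N ^ 2)) \<le> k * (4 * ?y)"
    proof (cases "p = 1")
      case True
      have "real k * (4 * ?y) \<ge> 0" by (intro mult_nonneg_nonneg divide_nonneg_nonneg) (auto simp: padded_edges_def)
      moreover have "?d = 0" using True by (simp add: nb_def)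
      ultimately show ?thesis by simp
    next
      case False
      have "(\<Sum>i<p. card (nb i)) \<le> k"
        unfolding nb_def H(3)[symmetric] by (rule sum_back_degrees_le[OF H(1) \<sigma>])
      then have "?d \<le> k" by (simp flip: of_nat_sum)
      moreover have "real (max m (n * N)) / (n * N ^ 2) \<le> 4 * ?y"
        using False root n by (intro round_term_le) (auto simp: N_def)
      ultimately show ?thesis by (intro mult_mono) auto
    qed
    moreover have "real (T m) \<le> 1 + 13 * real p + 240 * (?d * (real (max m (n * N)) / (n * N ^ 2)))"
      using P(4)[of m] by (simp add: mult.assoc)
    \<comment> \<open>The 2 stands for the preliminary degree round and the round in which edges are
      dealt.\<close>
    ultimately have "real (Suc (T m)) \<le> 2 + 13 * real p + 960 * (k * ?y)" by simp
    also have "\<dots> \<le> 960 * (k * ?y + real p)" using p(1) by simp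
    finally show ?thesis by (simp add: round_bound_def)
  qed
  \<comment> \<open>The outputs of the protocols for all \<open>m\<close> are merged into one
    function that reads \<open>m\<close> off the graph.\<close>
  have "clique_network.knows (graphs_on V m) (E m) v (\<lambda>G. out (card (edges G)) v G)" if "v \<in> V" for m v
    using P(2)[OF that, of m] by (auto simp: clique_network.knows_def graphs_on_def)
  then have "\<exists>A. \<forall>m. \<forall>G \<in> graphs_on V m.
      (\<forall>r. \<forall>u \<in> V. \<forall>v \<in> V. length (transmitted A u (incident G u) (history A G r u) v) \<le> b) \<and>
      (\<forall>v \<in> V. halted A v (incident G v) (history A G (Suc (T m)) v)) \<and>
      (\<forall>v \<in> V. node_output A G v = out (card (edges G)) v G)"
    using P(1) message_bits[OF n] V unfolding b_def by (intro algorithm_of_protocols) auto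
  then obtain A where A: "\<And>m G. G \<in> graphs_on V m \<Longrightarrow>
      (\<forall>r. \<forall>u \<in> V. \<forall>v \<in> V. length (transmitted A u (incident G u) (history A G r u) v) \<le> b) \<and>
      (\<forall>v \<in> V. halted A v (incident G v) (history A G (Suc (T m)) v)) \<and>
      (\<forall>v \<in> V. node_output A G v = out (card (edges G)) v G)"
    by blast
  show "\<exists>A :: cc_algorithm. \<forall>(G :: ugraph) (m :: nat).
       simple_graph G \<and> verts G = V \<and> card (edges G) = m \<longrightarrow>
       bandwidth_at_most A G (5 * log 2 (real n)) \<and>
       terminates_within A G (960 * round_bound n m p k) \<and>
       lists_all_copies A H G"
  proof (intro exI[of _ A] allI impI)
    fix G :: ugraph and m :: nat
    assume G: "simple_graph G \<and> verts G = V \<and> card (edges G) = m"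
    then have Gm: "G \<in> graphs_on V m" by (simp add: graphs_on_def)
    have "real b \<le> 5 * log 2 n" using p by (simp add: b_def)
    then have "bandwidth_at_most A G (5 * log 2 (real n))"
      unfolding bandwidth_at_most_def using A[OF Gm] G by (meson of_nat_mono order_trans)
    moreover have "terminates_within A G (960 * round_bound n m p k)"
      unfolding terminates_within_def using A[OF Gm] time[of m] G by blast
    moreover have "lists_all_copies A H G"
      using A[OF Gm] P(3)[OF Gm] G by (simp add: lists_all_copies_def)
    ultimately show "bandwidth_at_most A G (5 * log 2 (real n)) \<and>
       terminates_within A G (960 * round_bound n m p k) \<and> lists_all_copies A H G" by blast
  qed
qed

end
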